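(* Let $S=(r;m_2,m_3,\ldots,m_l)$ be a tree eccentric sequence, let $n$ and $d$ be the order and the diameter of the trees with eccentric sequence $S$, let $T\in\mathcal{T}_S$ and $k\in\{2,3,\ldots,n-1\}$. Then $$SW_k(T)\geq SW_k(\mathbf{T}(r;m_2,\ldots,m_l)).$$ If $k\leq n-\lceil \frac{d}{2}\rceil$, then equality implies that $T=\mathbf{T}(r;m_2,\ldots,m_l)$.
   Context: Graphs are finite and simple. For trees, $T_1=T_2$ means that $T_1$ and $T_2$ are isomorphic. The eccentricity of a vertex $v$ is $\max_u d(v,u)$. The eccentric sequence of a connected graph is the nondecreasing sequence of the eccentricities of its vertices. A tree eccentric sequence is a sequence that is the eccentric sequence of some tree; only trees with $n>2$ vertices are considered. For a tree, let $b_1<b_2<\cdots<b_l$ be the distinct eccentricities of its vertices and let $m_j$ be the number of vertices of eccentricity $b_j$. The $b_j$ are consecutive integers, $m_1\in\{1,2\}$, and the eccentric sequence is completely determined by $b_1,m_2,\ldots,m_l$; it is written $S=(b_1;m_2,m_3,\ldots,m_l)$. A tree with eccentric sequence $(r;m_2,\ldots,m_l)$ has radius $r$, diameter $d=r+l-1$, order $n=m_1+m_2+\cdots+m_l$, and exactly $m_j$ vertices of eccentricity $r+j-1$ for $2\le j\le l$. $\mathcal{T}_S$ denotes the set of all trees with eccentric sequence $S$. For integers $b_1>0$ and $m_2,\ldots,m_l>1$, $\mathbf{T}(b_1;m_2,\ldots,m_l)$ is the tree obtained from the path $v_0,v_1,\ldots,v_{b_1+l-1}$ by attaching $m_j-2$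 pendent edges to the vertex $v_{l+1-j}$ for all $2\le j\le l$. For a connected graph $G$ and a nonempty set $A\subseteq V(G)$, the Steiner distance $d(A)$ is the minimum number of edges in a subtree of $G$ whose vertex set contains $A$. The $k$-Steiner Wiener index is $SW_k(G)=\sum_{A\subseteq V(G),\,|A|=k} d(A)$. *)

theory Defs
  imports Complex_Main "HOL-Library.Multiset"
begin

(* Finite simple undirected graphs whose edges are two-element sets of vertices.
   The predicate tree of the AFP entry Graph_Theory does not apply: in a symmetric digraph
   u, v, u counts as a cycle, so no symmetric digraph with an edge is a tree in that sense. *)

record 'a ugraph =
  verts :: "'a set"
  edges :: "'a set set"

definition simple_graph :: "'a ugraph \<Rightarrow> bool" where
  "simple_graph G \<longleftrightarrow> finite (verts G) \<and> (\<forall>e\<in>edges G. e \<subseteq> verts G \<and> card e = 2)"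

(* A walk is the nonempty list of its vertices; p has length p - 1 edges. *)
definition walk :: "'a ugraph \<Rightarrow> 'a list \<Rightarrow> bool" where
  "walk G p \<longleftrightarrow> p \<noteq> [] \<and> set p \<subseteq> verts G \<and> successively (\<lambda>u v. {u, v} \<in> edges G) p"

definition walk_between :: "'a ugraph \<Rightarrow> 'a \<Rightarrow> 'a list \<Rightarrow> 'a \<Rightarrow> bool" where
  "walk_between G u p v \<longleftrightarrow> walk G p \<and> hd p = u \<and> last p = v"

definition connected_graph :: "'a ugraph \<Rightarrow> bool" where
  "connected_graph G \<longleftrightarrow> verts G \<noteq> {} \<and> (\<forall>u\<in>verts G. \<forall>v\<in>verts G. \<exists>p. walk_between G u p v)"

definition is_cycle :: "'a ugraph \<Rightarrow> 'a list \<Rightarrow> bool" where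
  "is_cycle G p \<longleftrightarrow> walk G p \<and> distinct p \<and> length p \<ge> 3 \<and> {last p, hd p} \<in> edges G"

definition is_tree :: "'a ugraph \<Rightarrow> bool" where
  "is_tree G \<longleftrightarrow> simple_graph G \<and> connected_graph G \<and> (\<nexists>p. is_cycle G p)"

definition is_subgraph :: "'a ugraph \<Rightarrow> 'a ugraph \<Rightarrow> bool" where
  "is_subgraph H G \<longleftrightarrow> simple_graph H \<and> verts H \<subseteq> verts G \<and> edges H \<subseteq> edges G"

definition isomorphic :: "'a ugraph \<Rightarrow> 'b ugraph \<Rightarrow> bool" where
  "isomorphic G H \<longleftrightarrow> (\<exists>f. bij_betw f (verts G) (verts H) \<and>
     (\<forall>u\<in>verts G. \<forall>v\<in>verts G. {u, v} \<in> edges G \<longleftrightarrow> {f u, f v} \<in> edges H))"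

definition order :: "'a ugraph \<Rightarrow> nat" where
  "order G = card (verts G)"

(* Meaningful for vertices joined by a walk, in particular on connected graphs. *)
definition distance :: "'a ugraph \<Rightarrow> 'a \<Rightarrow> 'a \<Rightarrow> nat" where
  "distance G u v = (LEAST m. \<exists>p. walk_between G u p v \<and> length p - 1 = m)"

definition eccentricity :: "'a ugraph \<Rightarrow> 'a \<Rightarrow> nat" where
  "eccentricity G v = Max (distance G v ` verts G)"

definition diameter :: "'a ugraph \<Rightarrow> nat" where
  "diameter G = Max (eccentricity G ` verts G)"

definition eccentric_sequence :: "'a ugraph \<Rightarrow> nat list" where
  "eccentric_sequence G = sorted_list_of_multiset (image_mset (eccentricity G) (mset_set (verts G)))"

(* Every finite graph has an isomorphic copy on natural numbers, so nat vertices suffice. *)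
definition tree_eccentric_sequence :: "nat list \<Rightarrow> bool" where
  "tree_eccentric_sequence S \<longleftrightarrow>
     (\<exists>T :: nat ugraph. is_tree T \<and> order T > 2 \<and> eccentric_sequence T = S)"

definition trees_with :: "nat list \<Rightarrow> 'a ugraph set" where
  "trees_with S = {T. is_tree T \<and> eccentric_sequence T = S}"

(* For a nondecreasing S, remdups S is b_1 < ... < b_l and count_list S b_j is m_j,
   so the result (r, ms) stands for (r; m_2, ..., m_l) with ms = [m_2, ..., m_l]. *)
definition short_form :: "nat list \<Rightarrow> nat \<times> nat list" where
  "short_form S = (hd (remdups S), map (count_list S) (tl (remdups S)))"

(* Vertices of the extremal tree: Spine i is v_i, and Pendant j t is the t-th of the
   m_j - 2 leaves attached to v_{l+1-j}. *)
datatype caterpillar_vertex = Spine nat | Pendant nat nat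

(* The list ms is [m_2, ..., m_l], so l = length ms + 1 and m_j = ms ! (j - 2).
   Meant for r > 0 and all entries of ms greater than 1. *)
definition extremal_tree :: "nat \<Rightarrow> nat list \<Rightarrow> caterpillar_vertex ugraph" where
  "extremal_tree r ms = (let l = length ms + 1; m = (\<lambda>j. ms ! (j - 2)) in
     \<lparr> verts = {Spine i | i. i \<le> r + l - 1}
         \<union> {Pendant j t | j t. 2 \<le> j \<and> j \<le> l \<and> 1 \<le> t \<and> t \<le> m j - 2},
       edges = {{Spine i, Spine (i + 1)} | i. i < r + l - 1}
         \<union> {{Spine (l + 1 - j), Pendant j t} | j t. 2 \<le> j \<and> j \<le> l \<and> 1 \<le> t \<and> t \<le> m j - 2} \<rparr>)"

definition steiner_distance :: "'a ugraph \<Rightarrow> 'a set \<Rightarrow> nat" where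
  "steiner_distance G A =
     (LEAST m. \<exists>H. is_subgraph H G \<and> is_tree H \<and> A \<subseteq> verts H \<and> card (edges H) = m)"

definition steiner_wiener :: "nat \<Rightarrow> 'a ugraph \<Rightarrow> nat" where
  "steiner_wiener k G = (\<Sum>A | A \<subseteq> verts G \<and> card A = k. steiner_distance G A)"

end

theory Submission
  imports Defs
begin

text \<open>
  The Steiner distance of a set in a tree is the number of edges that separate the set. Hence
  \<open>SW\<^sub>k\<close> is a sum over the edges (\<open>steiner_wiener_eq\<close>): in a tree of order \<open>n\<close>, an edge with \<open>s\<close>
  vertices on one side contributes the number of \<open>k\<close>-sets that it separates,
  \<open>f s = (n choose k) - (s choose k) - ((n - s) choose k)\<close>,
  and \<open>f\<close> is a symmetric and concave function of \<open>s\<close>.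

  Root the tree at its centre, which is a vertex or, for odd diameter, an edge, and put a vertex of
  eccentricity \<open>r + h\<close> on level \<open>h\<close>. Every vertex \<open>v\<close> of a positive level has a unique edge towards the
  centre; let \<open>s(v)\<close> be the number of vertices that this edge cuts off from the centre. Over a fixed
  level \<open>h\<close> the numbers \<open>s(v)\<close> add up to the number of vertices of level at least \<open>h\<close>, and the eccentric
  sequence determines this number as well as the number of summands. All \<open>s(v)\<close> are at least \<open>1\<close>, and
  if \<open>H\<close> is the highest level, then the two halves of a diametral path supply two vertices \<open>v\<close> on the level with
  \<open>s(v) \<ge> H - h + 1\<close>. As \<open>f\<close> is concave, the sum of the \<open>f(s(v))\<close> over the level is smallest when one
  of these two values is \<open>H - h + 1\<close>, all values at further vertices are \<open>1\<close>, and the rest is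
  concentrated in a single vertex (\<open>level_bound\<close>). The extremal tree attains this minimum
  on all levels at once. For odd diameter the central edge is bounded in the same way, because
  both of its sides have at least \<open>H + 1\<close> vertices (\<open>center_inequality\<close>). This is the inequality.

  In the case of equality the minimum is attained on each level. For \<open>k \<le> n - r\<close> the concavity is
  strict at the places that matter, so all vertices off the diametral path are leaves and, on the
  lowest level that has two vertices of the path, one of the two halves is a bare path
  (\<open>steiner_wiener_equality\<close>). All those leaves then hang on the other half, and the level sizes determine such
  a tree up to isomorphism (\<open>one_sided_isomorphic\<close>).

  That a tree has this layered structure is \<open>tree_levels\<close>: the root is a middle vertex of a
  shortest walk between two vertices at maximal distance.
\<close>

section \<open>Walks and distances\<close>

definition joined :: "'a ugraph \<Rightarrow> nat \<Rightarrow> 'a \<Rightarrow> 'a \<Rightarrow> bool" where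
  "joined G m u v \<longleftrightarrow> (\<exists>p. walk_between G u p v \<and> length p = Suc m)"

lemma joined_refl: "v \<in> verts G \<Longrightarrow> joined G 0 v v"
  unfolding joined_def walk_between_def walk_def by (intro exI[of _ "[v]"]) auto

lemma joined_edge:
  assumes "{u, v} \<in> edges G" "u \<in> verts G" "v \<in> verts G"
  shows "joined G 1 u v"
  unfolding joined_def walk_between_def walk_def using assms by (intro exI[of _ "[u, v]"]) auto

lemma joined_trans:
  assumes "joined G a u v" "joined G b v w"
  shows "joined G (a + b) u w"
proof -
  obtain p where p: "walk G p" "hd p = u" "last p = v" "length p = Suc a"
    using assms(1) unfolding joined_def walk_between_def by auto
  obtain q where q: "walk G q" "hd q = v" "last q = w" "length q = Suc b"
    using assms(2) unfolding joined_def walk_between_def by auto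
  obtain q' where qq: "q = v # q'" using q by (cases q) auto
  have "walk G (p @ q')" using p q unfolding walk_def qq
    by (cases q') (auto simp: successively_append_iff)
  moreover have "last (p @ q') = w" using p q qq by auto
  moreover have "hd (p @ q') = u" using p by (cases p) auto
  moreover have "length (p @ q') = Suc (a + b)" using p q qq by auto
  ultimately show ?thesis unfolding joined_def walk_between_def by blast
qed

lemma joined_sym:
  assumes "joined G a u v"
  shows "joined G a v u"
proof -
  obtain p where p: "walk G p" "hd p = u" "last p = v" "length p = Suc a"
    using assms(1) unfolding joined_def walk_between_def by auto
  have "walk G (rev p)" using p(1) unfolding walk_def by (auto simp: insert_commute)
  then show ?thesis using p unfolding joined_def walk_between_def walk_def
    by (intro exI[of _ "rev p"]) (auto simp: hd_rev last_rev)
qed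

lemma walk_split:
  assumes "walk_between G u (p1 @ v # p2) w"
  shows "joined G (length p1) u v" "joined G (length p2) v w"
proof -
  have "walk_between G u (p1 @ [v]) v"
    using assms unfolding walk_between_def walk_def
    by (auto simp: successively_append_iff hd_append)
  then show "joined G (length p1) u v" unfolding joined_def by (intro exI[of _ "p1 @ [v]"]) auto
  have "walk_between G v (v # p2) w"
    using assms unfolding walk_between_def walk_def
    by (auto simp: successively_append_iff hd_append)
  then show "joined G (length p2) v w" unfolding joined_def by (intro exI[of _ "v # p2"]) auto
qed

lemma joined_in_verts: "joined G m u v \<Longrightarrow> u \<in> verts G \<and> v \<in> verts G"
  unfolding joined_def walk_between_def walk_def by (metis hd_in_set last_in_set subsetD)

lemma walk_between_distinct:
  assumes "walk_between G u p v"
  shows "\<exists>q. walk_between G u q v \<and> distinct q"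
  using assms
proof (induction p arbitrary: u)
  case Nil then show ?case by (simp add: walk_between_def walk_def)
next
  case (Cons a p)
  show ?case
  proof (cases p)
    case Nil
    then show ?thesis using Cons.prems by (intro exI[of _ "a # p"]) auto
  next
    case (Cons b p')
    have "walk_between G b p v" and ua: "u = a" "a \<in> verts G" "{a, b} \<in> edges G"
      using Cons.prems Cons unfolding walk_between_def walk_def by auto
    then obtain q where q: "walk_between G b q v" "distinct q" using Cons.IH by blast
    show ?thesis
    proof (cases "a \<in> set q")
      case True
      then obtain q1 q2 where qs: "q = q1 @ a # q2" by (auto dest: split_list)
      have "walk_between G a (a # q2) v"
        using q(1) unfolding qs walk_between_def walk_def by (auto simp: successively_append_iff)
      then show ?thesis using q(2) qs ua by (intro exI[of _ "a # q2"]) auto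
    next
      case False
      obtain q' where "q = b # q'" using q(1) unfolding walk_between_def walk_def by (cases q) auto
      then have "walk_between G a (a # q) v" using q(1) ua unfolding walk_between_def walk_def by auto
      then show ?thesis using False q(2) ua by (intro exI[of _ "a # q"]) auto
    qed
  qed
qed

text \<open>
A walk that leaves \<open>X\<close> uses an edge of the graph between \<open>X\<close> and its complement. In a tree only
one edge joins a branch to the rest, so this locates the edge in every walk out of the branch.
\<close>
lemma walk_crosses:
  assumes "walk_between G a p b" "a \<in> X" "b \<notin> X"
  shows "\<exists>u w. u \<in> X \<and> w \<notin> X \<and> {u, w} \<in> edges G \<and> u \<in> set p \<and> w \<in> set p"
  using assms
proof (induction p arbitrary: a)
  case Nil then show ?case by (simp add: walk_between_def walk_def)
next
  case (Cons u p)
  obtain w p' where p: "p = w # p'" 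
    using Cons.prems unfolding walk_between_def by (cases p) auto
  have e: "{u, w} \<in> edges G" "walk_between G w p b" "u = a"
    using Cons.prems(1) unfolding walk_between_def walk_def p by auto
  show ?case
  proof (cases "w \<in> X")
    case True
    then show ?thesis using Cons.IH[OF e(2) True Cons.prems(3)] by auto
  next
    case False
    then show ?thesis using e Cons.prems p by auto
  qed
qed

lemma distance_Least: "distance G u v = (LEAST m. joined G m u v)"
proof -
  have "(\<exists>p. walk_between G u p v \<and> length p - 1 = m) \<longleftrightarrow> joined G m u v" for m
    unfolding joined_def walk_between_def walk_def
    by (metis Suc_pred diff_Suc_1 length_greater_0_conv)
  then show ?thesis unfolding distance_def by simp
qed

lemma distance_le: "joined G m u v \<Longrightarrow> distance G u v \<le> m"
  unfolding distance_Least by (rule Least_le)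

lemma distance_sym: "distance G u v = distance G v u"
  unfolding distance_Least by (metis joined_sym)

lemma connected_joined:
  assumes "connected_graph G" "u \<in> verts G" "v \<in> verts G"
  shows "joined G (distance G u v) u v"
proof -
  obtain p where "walk_between G u p v" using assms unfolding connected_graph_def by blast
  then have "joined G (length p - 1) u v"
    unfolding joined_def walk_between_def walk_def by (intro exI[of _ p]) auto
  then show ?thesis unfolding distance_Least by (rule LeastI)
qed

lemma distance_triangle:
  assumes "connected_graph G" "u \<in> verts G" "v \<in> verts G" "w \<in> verts G"
  shows "distance G u w \<le> distance G u v + distance G v w"
  using assms by (intro distance_le joined_trans[of _ _ _ v] connected_joined)

text \<open>
If \<open>v\<close> is a cut vertex between \<open>u\<close> and \<open>w\<close>, then a shortest walk splits at \<open>v\<close> and the triangle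
inequality is an equality.
\<close>
lemma distance_through:
  assumes conn: "connected_graph G" and uw: "u \<in> verts G" "w \<in> verts G"
    and through: "\<And>p. walk_between G u p w \<Longrightarrow> v \<in> set p"
  shows "distance G u w = distance G u v + distance G v w"
proof -
  obtain p where p: "walk_between G u p w" "length p = Suc (distance G u w)"
    using connected_joined[OF conn uw] unfolding joined_def by auto
  obtain p1 p2 where ps: "p = p1 @ v # p2" using split_list[OF through[OF p(1)]] by auto
  have "distance G u v + distance G v w \<le> length p1 + length p2"
    using walk_split[OF p(1)[unfolded ps]] by (intro add_mono distance_le)
  also have "\<dots> = distance G u w" using p(2) ps by simp
  finally have "distance G u v + distance G v w \<le> distance G u w" .
  moreover have "v \<in> verts G" using p(1) ps unfolding walk_between_def walk_def by auto
  ultimately show ?thesis using distance_triangle[OF conn uw(1) _ uw(2), of v] by simp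
qed

lemma distance_self: "v \<in> verts G \<Longrightarrow> distance G v v = 0"
  using distance_le[OF joined_refl] by simp

lemma distance_pos:
  assumes "connected_graph G" "u \<in> verts G" "v \<in> verts G" "u \<noteq> v"
  shows "distance G u v > 0"
proof (rule ccontr)
  assume "\<not> ?thesis"
  then have "joined G 0 u v" using connected_joined[OF assms(1-3)] by simp
  then obtain a where "walk_between G u [a] v" unfolding joined_def by (auto simp: length_Suc_conv)
  then show False using assms(4) unfolding walk_between_def by auto
qed

section \<open>Trees given by a parent function\<close>

definition parent_graph :: "'a set \<Rightarrow> 'a \<Rightarrow> ('a \<Rightarrow> 'a) \<Rightarrow> 'a ugraph" where
  "parent_graph V c p = \<lparr> verts = V, edges = {{v, p v} | v. v \<in> V - {c}} \<rparr>"

text \<open>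
The function \<open>dep\<close> only has to decrease towards the root, which excludes cycles of parents. It may
start at any value, so that the same function serves for subtrees with another root.
\<close>
locale rooted_tree =
  fixes V :: "'a set" and c :: 'a and p :: "'a \<Rightarrow> 'a" and dep :: "'a \<Rightarrow> nat"
  assumes finite_V: "finite V"
    and root_in: "c \<in> V"
    and parent_in: "\<And>v. v \<in> V \<Longrightarrow> v \<noteq> c \<Longrightarrow> p v \<in> V"
    and dep_parent: "\<And>v. v \<in> V \<Longrightarrow> v \<noteq> c \<Longrightarrow> dep (p v) < dep v"
begin

abbreviation G :: "'a ugraph" where "G \<equiv> parent_graph V c p"

definition up :: "('a \<times> 'a) set" where "up = {(v, p v) | v. v \<in> V - {c}}"

definition below :: "'a \<Rightarrow> 'a set" where "below v = {u \<in> V. (u, v) \<in> up\<^sup>*}"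

lemma verts_G [simp]: "verts G = V"
  and edges_G: "edges G = {{v, p v} | v. v \<in> V - {c}}"
  unfolding parent_graph_def by simp_all

lemma parent_neq: "v \<in> V \<Longrightarrow> v \<noteq> c \<Longrightarrow> p v \<noteq> v"
  using dep_parent by fastforce

lemma simple_G: "simple_graph G"
  unfolding simple_graph_def edges_G using finite_V parent_in
  by (auto simp: card_insert_if dest: parent_neq[symmetric])

lemma up_single_valued: "single_valued up"
  unfolding up_def single_valued_def by auto

lemma up_closed: "(u, v) \<in> up\<^sup>* \<Longrightarrow> u \<in> V \<Longrightarrow> v \<in> V"
  by (induction rule: rtrancl_induct) (auto simp: up_def parent_in)

lemma up_dep: "(u, v) \<in> up\<^sup>* \<Longrightarrow> u = v \<or> dep v < dep u"
proof (induction rule: rtrancl_induct)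
  case (step v w)
  then show ?case using dep_parent by (auto simp: up_def dest: less_trans)
qed simp

lemma below_subset: "below v \<subseteq> V" unfolding below_def by auto

lemma self_below: "v \<in> V \<Longrightarrow> v \<in> below v" unfolding below_def by simp

lemma below_root:
  assumes "v \<in> V" shows "v \<in> below c"
  using assms
proof (induction "dep v" arbitrary: v rule: less_induct)
  case less
  show ?case
  proof (cases "v = c")
    case True then show ?thesis using less by (simp add: self_below)
  next
    case False
    then have "p v \<in> below c" using less dep_parent parent_in by blast
    then show ?thesis using less False unfolding below_def
      by (auto simp: up_def intro: converse_rtrancl_into_rtrancl)
  qed
qed

lemma below_parent:
  assumes "u \<in> below v" "u \<noteq> v"
  shows "p u \<in> below v" "u \<noteq> c"
proof -
  from assms obtain w where "(u, w) \<in> up" "(w, v) \<in> up\<^sup>*"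
    unfolding below_def by (auto elim: converse_rtranclE)
  then show "p u \<in> below v" "u \<noteq> c" using parent_in unfolding below_def up_def by auto
qed

lemma parent_below_iff:
  assumes "u \<in> V" "u \<noteq> c" "p u \<in> below v" shows "u \<in> below v"
  using assms unfolding below_def by (auto simp: up_def intro: converse_rtrancl_into_rtrancl)

lemma below_trans: "u \<in> below v \<Longrightarrow> v \<in> below w \<Longrightarrow> u \<in> below w"
  unfolding below_def by auto

lemma below_comparable:
  assumes "u \<in> below v" "u \<in> below w"
  shows "v \<in> below w \<or> w \<in> below v"
proof -
  have "(v, w) \<in> up\<^sup>* \<or> (w, v) \<in> up\<^sup>*"
    using assms single_valued_confluent[OF up_single_valued] unfolding below_def by auto
  moreover have "v \<in> V" "w \<in> V" using assms up_closed unfolding below_def by auto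
  ultimately show ?thesis unfolding below_def by auto
qed

lemma joined_below:
  assumes "u \<in> below v" shows "\<exists>m. joined G m u v"
  using assms
proof (induction "dep u" arbitrary: u rule: less_induct)
  case less
  show ?case
  proof (cases "u = v")
    case True then show ?thesis using less joined_refl[of u G] below_subset by auto
  next
    case False
    from below_parent[OF less.prems False] have pu: "p u \<in> below v" "u \<noteq> c" .
    have uV: "u \<in> V" using less.prems below_subset by auto
    obtain m where "joined G m (p u) v" using less.hyps[OF dep_parent[OF uV pu(2)] pu(1)] by auto
    moreover have "joined G 1 u (p u)"
      using uV pu(2) parent_in by (intro joined_edge) (auto simp: edges_G)
    ultimately show ?thesis using joined_trans by metis
  qed
qed

lemma connected_G: "connected_graph G"
  unfolding connected_graph_def
proof (intro conjI ballI)
  show "verts G \<noteq> {}" using root_in by auto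
  fix u v assume "u \<in> verts G" "v \<in> verts G"
  then obtain a b where "joined G a u c" "joined G b v c"
    using joined_below below_root by (metis verts_G)
  then have "joined G (a + b) u v" using joined_trans joined_sym by metis
  then show "\<exists>p. walk_between G u p v" unfolding joined_def by auto
qed

lemma edge_cases:
  assumes "{u, v} \<in> edges G"
  obtains "u \<in> V" "u \<noteq> c" "v = p u" | "v \<in> V" "v \<noteq> c" "u = p v"
  using assms unfolding edges_G by (auto simp: doubleton_eq_iff)

text \<open>
A vertex of maximal \<open>dep\<close> on a cycle would have its parent as both of its neighbours.
\<close>
lemma acyclic_G: "\<not> is_cycle G q"
proof
  assume cyc: "is_cycle G q"
  let ?n = "length q"
  have n3: "?n \<ge> 3" and dist: "distinct q" and ne: "q \<noteq> []"
    and sub: "set q \<subseteq> V" using cyc unfolding is_cycle_def walk_def by auto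
  have edge: "{q ! i, q ! (Suc i mod ?n)} \<in> edges G" if "i < ?n" for i
  proof (cases "Suc i < ?n")
    case True
    then show ?thesis using cyc unfolding is_cycle_def walk_def
      by (auto simp: successively_conv_nth)
  next
    case False
    then have "Suc i = ?n" using that by simp
    then show ?thesis using cyc ne unfolding is_cycle_def
      by (simp add: last_conv_nth hd_conv_nth flip: \<open>Suc i = ?n\<close>)
  qed
  have "finite (dep ` set q)" "dep ` set q \<noteq> {}" using ne by auto
  then have "Max (dep ` set q) \<in> dep ` set q" by (rule Max_in)
  then obtain v where "v \<in> set q" "dep v = Max (dep ` set q)" by auto
  then have v: "v \<in> set q" "\<And>w. w \<in> set q \<Longrightarrow> dep w \<le> dep v" by auto
  have nb: "w = p v" if "{v, w} \<in> edges G" "w \<in> set q" for w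
    using that(1)
  proof (cases rule: edge_cases)
    case 2 then show ?thesis using v(2)[OF that(2)] dep_parent by fastforce
  qed
  obtain i where i: "i < ?n" "q ! i = v" using v(1) by (auto simp: in_set_conv_nth)
  define j where "j = (if i = 0 then ?n - 1 else i - 1)"
  have j: "j < ?n" "Suc j mod ?n = i" using i n3 unfolding j_def by auto
  have m: "Suc i mod ?n < ?n" using ne by (intro mod_less_divisor) simp
  have "q ! (Suc i mod ?n) = p v" using edge[OF i(1)] i m by (intro nb) auto
  moreover have "q ! j = p v" using edge[OF j(1)] i j by (intro nb) (auto simp: insert_commute)
  ultimately have "Suc i mod ?n = j" using nth_eq_iff_index_eq[OF dist m j(1)] by simp
  then show False using i n3 unfolding j_def
    by (cases "Suc i = ?n") (auto split: if_splits)
qed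

lemma is_tree_G: "is_tree G"
  unfolding is_tree_def using simple_G connected_G acyclic_G by blast

lemma crossing_edge:
  assumes "{a, b} \<in> edges G" "a \<in> below v" "b \<notin> below v"
  shows "a = v" "b = p v" "v \<noteq> c"
  using assms(1)
proof (atomize (full), cases rule: edge_cases)
  case 1
  then show "a = v \<and> b = p v \<and> v \<noteq> c" using assms below_parent by blast
next
  case 2
  then show "a = v \<and> b = p v \<and> v \<noteq> c" using assms parent_below_iff by blast
qed

lemma inj_parent_edge: "inj_on (\<lambda>v. {v, p v}) (V - {c})"
proof (rule inj_onI)
  fix v w assume *: "v \<in> V - {c}" "w \<in> V - {c}" "{v, p v} = {w, p w}"
  show "v = w"
  proof (rule ccontr)
    assume "v \<noteq> w"
    then have "v = p w" "w = p v" using *(3) by (auto simp: doubleton_eq_iff)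
    then show False using dep_parent[of v] dep_parent[of w] * by auto
  qed
qed

lemma card_edges_G: "card (edges G) = card (V - {c})"
proof -
  have "edges G = (\<lambda>v. {v, p v}) ` (V - {c})" unfolding edges_G by auto
  then show ?thesis using card_image[OF inj_parent_edge] by simp
qed

text \<open>
The edge from \<open>v\<close> to its parent separates \<open>A\<close> iff \<open>A\<close> has elements both below \<open>v\<close> and elsewhere;
each such edge is represented by its lower end.
\<close>
definition separators :: "'a set \<Rightarrow> 'a set" where
  "separators A = {v \<in> V - {c}. below v \<inter> A \<noteq> {} \<and> \<not> A \<subseteq> below v}"

text \<open>
A connected subgraph that contains \<open>A\<close> has a walk across every separating edge, and the crossing
can use that edge only.
\<close>
lemma steiner_lower:
  assumes H: "is_subgraph H G" "is_tree H" "A \<subseteq> verts H"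
  shows "card (separators A) \<le> card (edges H)"
proof -
  have "(\<lambda>v. {v, p v}) ` separators A \<subseteq> edges H"
  proof safe
    fix v assume v: "v \<in> separators A"
    then obtain a b where ab: "a \<in> A" "a \<in> below v" "b \<in> A" "b \<notin> below v"
      unfolding separators_def by auto
    then obtain q where "walk_between H a q b" using H
      unfolding is_tree_def connected_graph_def by blast
    from walk_crosses[OF this ab(2,4)] obtain u w where
      uw: "u \<in> below v" "w \<notin> below v" "{u, w} \<in> edges H" by blast
    then have "{u, w} \<in> edges G" using H(1) unfolding is_subgraph_def by auto
    from crossing_edge[OF this uw(1,2)] show "{v, p v} \<in> edges H" using uw(3) by simp
  qed
  moreover have "finite (edges H)"
    by (rule finite_subset[of _ "edges G"]) (use H(1) finite_V in \<open>auto simp: is_subgraph_def edges_G\<close>)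
  moreover have "inj_on (\<lambda>v. {v, p v}) (separators A)"
    by (rule inj_on_subset[OF inj_parent_edge]) (auto simp: separators_def)
  ultimately show ?thesis using card_image card_mono by metis
qed

text \<open>
The separating edges themselves form a tree that contains \<open>A\<close>: its root \<open>z\<close> is the deepest vertex
that has all of \<open>A\<close> below it, and its other vertices are the separators, with their old parents.
\<close>
lemma steiner_attained:
  assumes A: "A \<subseteq> V" "A \<noteq> {}"
  shows "\<exists>H. is_subgraph H G \<and> is_tree H \<and> A \<subseteq> verts H \<and> card (edges H) = card (separators A)"
proof -
  let ?C = "{v \<in> V. A \<subseteq> below v}"
  have "c \<in> ?C" using A below_root root_in by auto
  then have "finite (dep ` ?C)" "dep ` ?C \<noteq> {}" using finite_V by auto
  then have "Max (dep ` ?C) \<in> dep ` ?C" by (rule Max_in)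
  then obtain z where z: "z \<in> ?C" and "dep z = Max (dep ` ?C)" by auto
  with \<open>finite (dep ` ?C)\<close> have zmax: "\<And>v. v \<in> ?C \<Longrightarrow> dep v \<le> dep z" by auto
  let ?Q = "separators A"
  have zQ: "z \<notin> ?Q" using z unfolding separators_def by auto
  have par: "p v \<in> insert z ?Q" if v: "v \<in> ?Q" for v
  proof -
    obtain a where a: "a \<in> A" "a \<in> below v" and vV: "v \<in> V" "v \<noteq> c" and nsub: "\<not> A \<subseteq> below v"
      using v unfolding separators_def by auto
    have vp: "v \<in> below (p v)" using vV self_below parent_in parent_below_iff by auto
    have ap: "a \<in> below (p v)" using a(2) vp below_trans by blast
    show ?thesis
    proof (cases "A \<subseteq> below (p v)")
      case False
      then have "p v \<noteq> c" using below_root A by auto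
      then show ?thesis using False a ap parent_in[OF vV] unfolding separators_def by auto
    next
      case True
      \<comment> \<open>Otherwise \<open>p v\<close> would be a deeper vertex than \<open>z\<close> that has all of \<open>A\<close> below it.\<close>
      have "z = p v"
      proof (rule ccontr)
        assume ne: "z \<noteq> p v"
        have az: "a \<in> below z" using z a by auto
        have "z \<in> below v \<or> v \<in> below z" using below_comparable az a by blast
        moreover have "z \<notin> below v" using nsub z below_trans by blast
        ultimately have "v \<in> below z" "v \<noteq> z" using z self_below by auto
        then have "p v \<in> below z" using below_parent by blast
        then have "dep z < dep (p v)" using ne up_dep unfolding below_def by auto
        moreover have "dep (p v) \<le> dep z" using zmax True parent_in[OF vV] by auto
        ultimately show False by simp
      qed
      then show ?thesis by simp
    qed
  qed
  interpret S: rooted_tree "insert z ?Q" z p dep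
    using par finite_V dep_parent by unfold_locales (auto simp: separators_def)
  let ?H = "parent_graph (insert z ?Q) z p"
  have "insert z ?Q \<subseteq> V" using z unfolding separators_def by auto
  moreover have "edges ?H \<subseteq> edges G" unfolding S.edges_G unfolding edges_G separators_def by auto
  ultimately have "is_subgraph ?H G" unfolding is_subgraph_def using S.simple_G by simp
  moreover have "A \<subseteq> insert z ?Q"
  proof
    fix a assume a: "a \<in> A"
    show "a \<in> insert z ?Q"
    proof (cases "A \<subseteq> below a")
      case True
      have "dep a \<le> dep z" using zmax True A a by auto
      moreover have "a \<in> below z" using a z by auto
      ultimately show ?thesis using up_dep unfolding below_def by fastforce
    next
      case False
      then show ?thesis using a A self_below below_root unfolding separators_def by fast
    qed
  qed
  moreover have "card (edges ?H) = card ?Q" using S.card_edges_G zQ by simp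
  ultimately show ?thesis using S.is_tree_G S.verts_G by metis
qed

lemma steiner_distance_eq:
  assumes "A \<subseteq> V" "A \<noteq> {}"
  shows "steiner_distance G A = card (separators A)"
  unfolding steiner_distance_def
  using steiner_attained[OF assms] steiner_lower by (intro Least_equality) blast+

end

lemma card_filter_eq_sum:
  "finite X \<Longrightarrow> card {x \<in> X. P x} = (\<Sum>x\<in>X. if P x then 1 else 0)"
  by (simp flip: sum.inter_filter)

text \<open>
The number of \<open>k\<close>-sets that an edge separates when it splits \<open>n\<close> vertices into \<open>s\<close> and \<open>n - s\<close>.
\<close>
definition cut_count :: "nat \<Rightarrow> nat \<Rightarrow> nat \<Rightarrow> int" where
  "cut_count n k s = int (n choose k) - int (s choose k) - int ((n - s) choose k)"

lemma card_separated_subsets: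
  assumes V: "finite V" and B: "B \<subseteq> V" and k: "k \<ge> 1"
  shows "int (card {A. A \<subseteq> V \<and> card A = k \<and> B \<inter> A \<noteq> {} \<and> \<not> A \<subseteq> B})
    = cut_count (card V) k (card B)"
proof -
  let ?S = "\<lambda>X. {A. A \<subseteq> X \<and> card A = k}"
  have fin: "finite (?S X)" if "X \<subseteq> V" for X
    by (rule finite_subset[of _ "Pow V"]) (use V that in auto)
  have "A \<subseteq> V \<Longrightarrow> (B \<inter> A \<noteq> {} \<and> \<not> A \<subseteq> B) \<longleftrightarrow> \<not> (A \<subseteq> B \<or> A \<subseteq> V - B)" for A
    by blast
  then have "{A. A \<subseteq> V \<and> card A = k \<and> B \<inter> A \<noteq> {} \<and> \<not> A \<subseteq> B} = ?S V - (?S B \<union> ?S (V - B))"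
    by blast
  moreover have "?S B \<inter> ?S (V - B) = {}" 
  proof (rule ccontr)
    assume "?S B \<inter> ?S (V - B) \<noteq> {}"
    then obtain A where A: "A \<subseteq> B" "A \<subseteq> V - B" "card A = k" by blast
    then have "A = {}" by blast
    then show False using A k by simp
  qed
  moreover have "?S B \<union> ?S (V - B) \<subseteq> ?S V" using B by auto
  moreover have "card (?S X) = card X choose k" if "X \<subseteq> V" for X
    using n_subsets[OF finite_subset[OF that V]] .
  moreover have "card (V - B) = card V - card B" using V B by (intro card_Diff_subset) (auto dest: finite_subset)
  ultimately have "card {A. A \<subseteq> V \<and> card A = k \<and> B \<inter> A \<noteq> {} \<and> \<not> A \<subseteq> B}
      = (card V choose k) - ((card B choose k) + ((card V - card B) choose k))"
    and "(card B choose k) + ((card V - card B) choose k) \<le> card V choose k"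
    using B fin[of B] fin[of "V - B"] fin[of V] card_mono[of "?S V" "?S B \<union> ?S (V - B)"]
    by (simp_all add: card_Diff_subset card_Un_disjoint)
  then show ?thesis unfolding cut_count_def by linarith
qed

context rooted_tree
begin

text \<open>
Double counting of the pairs of a \<open>k\<close>-set and an edge that separates it.
\<close>
lemma steiner_wiener_eq:
  assumes k: "k \<ge> 1"
  shows "int (steiner_wiener k G) = (\<Sum>v\<in>V - {c}. cut_count (card V) k (card (below v)))"
proof -
  let ?K = "{A. A \<subseteq> V \<and> card A = k}"
  have fK: "finite ?K" using finite_V by (intro finite_subset[of ?K "Pow V"]) auto
  have "steiner_wiener k G = (\<Sum>A\<in>?K. card (separators A))"
    unfolding steiner_wiener_def verts_G using k
    by (intro sum.cong refl steiner_distance_eq) auto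
  also have "\<dots> = (\<Sum>A\<in>?K. \<Sum>v\<in>V - {c}. if below v \<inter> A \<noteq> {} \<and> \<not> A \<subseteq> below v then 1 else 0)"
    using card_filter_eq_sum[of "V - {c}"] finite_V unfolding separators_def by simp
  also have "\<dots> = (\<Sum>v\<in>V - {c}. \<Sum>A\<in>?K. if below v \<inter> A \<noteq> {} \<and> \<not> A \<subseteq> below v then 1 else 0)"
    by (rule sum.swap)
  also have "\<dots> = (\<Sum>v\<in>V - {c}. card {A. A \<subseteq> V \<and> card A = k \<and> below v \<inter> A \<noteq> {} \<and> \<not> A \<subseteq> below v})"
    using card_filter_eq_sum[OF fK] by (simp add: conj_assoc)
  finally have "steiner_wiener k G = \<dots>" .
  then show ?thesis
    by (simp only: of_nat_sum card_separated_subsets[OF finite_V below_subset k])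
qed

end

section \<open>Concavity of the cut counts\<close>

lemma choose_strict_mono:
  assumes "a < b" "1 \<le> k" "k \<le> b"
  shows "a choose k < b choose k"
proof -
  obtain b' k' where bk: "b = Suc b'" "k = Suc k'" using assms by (cases b; cases k) auto
  have "a choose k \<le> b' choose k" using assms bk by (intro binomial_right_mono) auto
  moreover have "b' choose k' > 0" using assms bk by simp
  ultimately show ?thesis unfolding bk binomial_Suc_Suc by linarith
qed

text \<open>
Convexity of \<open>m choose k\<close> in \<open>m\<close>: by Pascal's rule, adding \<open>t\<close> to the larger base gains at least
as much as adding it to the smaller one.
\<close>
lemma choose_exchange:
  "(L + t choose k) + (L + u choose k) \<le> (L choose k) + (L + t + u choose k)"
proof (cases k)
  case (Suc j)
  show ?thesis unfolding Suc
  proof (induction t)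
    case (Suc t)
    have "L + t choose j \<le> L + t + u choose j" by (intro binomial_right_mono) simp
    then show ?case using Suc by simp
  qed simp
qed simp

lemma choose_exchange_strict:
  assumes "t > 0" "u > 0" "2 \<le> k" "k \<le> L + t + u"
  shows "(L + t choose k) + (L + u choose k) < (L choose k) + (L + t + u choose k)"
proof -
  obtain t' j where tj: "t = Suc t'" "k = Suc j" using assms by (cases t; cases k) auto
  have "L + t' choose j < L + t' + u choose j" using assms tj by (intro choose_strict_mono) auto
  then show ?thesis using choose_exchange[of L t' k u] unfolding tj by simp
qed

text \<open>
Concavity of the cut counts, as an exchange: pushing \<open>a\<close> down to \<open>L\<close> and \<open>b\<close> up by the same amount
does not increase the sum. The bound \<open>k \<le> n - L\<close> makes the largest of the complementary
binomial coefficients positive, which is what strictness rests on.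
\<close>
lemma cut_exchange:
  assumes "L \<le> a" "L \<le> b" "a + b - L \<le> n"
  shows "cut_count n k L + cut_count n k (a + b - L) \<le> cut_count n k a + cut_count n k b"
    and "L < a \<Longrightarrow> L < b \<Longrightarrow> 2 \<le> k \<Longrightarrow> k \<le> n - L \<Longrightarrow>
      cut_count n k L + cut_count n k (a + b - L) < cut_count n k a + cut_count n k b"
proof -
  define t u M where "t = a - L" and "u = b - L" and "M = n - (a + b - L)"
  have eqs: "a = L + t" "b = L + u" "n = M + L + t + u" "a + b - L = L + t + u"
    "n - a = M + u" "n - b = M + t" "n - L = M + t + u" "n - (a + b - L) = M"
    using assms unfolding t_def u_def M_def by auto
  show "cut_count n k L + cut_count n k (a + b - L) \<le> cut_count n k a + cut_count n k b"
    unfolding cut_count_def eqs(5-8) unfolding eqs(4) unfolding eqs(1,2)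
    using choose_exchange[of L t k u] choose_exchange[of M t k u] by linarith
  assume "L < a" "L < b" "2 \<le> k" "k \<le> n - L"
  then show "cut_count n k L + cut_count n k (a + b - L) < cut_count n k a + cut_count n k b"
    unfolding cut_count_def eqs(5-8) unfolding eqs(4) unfolding eqs(1,2)
    using choose_exchange[of L t k u] choose_exchange_strict[of t u k M] by linarith
qed

lemma cut_count_sym: "s \<le> n \<Longrightarrow> cut_count n k (n - s) = cut_count n k s"
  unfolding cut_count_def by simp

text \<open>
Shrinking all \<open>s j\<close> to \<open>1\<close> and moving the excess into \<open>a\<close> is a sequence of exchanges with \<open>L = 1\<close>.
\<close>
lemma cut_sum_collect:
  assumes "finite J" "1 \<le> a" "\<And>j. j \<in> J \<Longrightarrow> 1 \<le> s j" "a + (\<Sum>j\<in>J. s j - 1) \<le> n"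
  shows "cut_count n k (a + (\<Sum>j\<in>J. s j - 1)) + int (card J) * cut_count n k 1
    \<le> cut_count n k a + (\<Sum>j\<in>J. cut_count n k (s j))"
  using assms
proof (induction J arbitrary: a rule: finite_induct)
  case (insert j J)
  have sj: "1 \<le> s j" using insert by auto
  have le: "a + s j - 1 + (\<Sum>j\<in>J. s j - 1) \<le> n" using insert.prems(3) insert.hyps sj by simp
  have "cut_count n k (a + s j - 1 + (\<Sum>j\<in>J. s j - 1)) + int (card J) * cut_count n k 1
    \<le> cut_count n k (a + s j - 1) + (\<Sum>j\<in>J. cut_count n k (s j))"
  proof (rule insert.IH)
    show "1 \<le> a + s j - 1" using insert.prems(1) sj by linarith
    show "1 \<le> s i" if "i \<in> J" for i using insert.prems(2) that by blast
  qed (use le in simp)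
  moreover have "cut_count n k 1 + cut_count n k (a + s j - 1) \<le> cut_count n k a + cut_count n k (s j)"
    using insert.prems(1) sj le by (intro cut_exchange) linarith+
  ultimately show ?case using insert.hyps sj by (simp add: algebra_simps)
qed simp

text \<open>
It suffices to perform the exchange at the given \<open>j\<close> first, which is strict because both
\<open>a\<close> and \<open>s j\<close> exceed \<open>1\<close>.
\<close>
lemma cut_sum_collect_strict:
  assumes J: "finite J" and a: "2 \<le> a" and s: "\<And>j. j \<in> J \<Longrightarrow> 1 \<le> s j"
    and n: "a + (\<Sum>j\<in>J. s j - 1) \<le> n" and k: "2 \<le> k" "k < n"
    and j: "j \<in> J" "s j \<noteq> 1"
  shows "cut_count n k (a + (\<Sum>j\<in>J. s j - 1)) + int (card J) * cut_count n k 1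
    < cut_count n k a + (\<Sum>j\<in>J. cut_count n k (s j))"
proof -
  have sj: "2 \<le> s j" using s[OF j(1)] j(2) by simp
  have split: "(\<Sum>j\<in>J. s j - 1) = (s j - 1) + (\<Sum>j\<in>J - {j}. s j - 1)"
    "(\<Sum>j\<in>J. cut_count n k (s j)) = cut_count n k (s j) + (\<Sum>j\<in>J - {j}. cut_count n k (s j))"
    by (rule sum.remove[OF J j(1)])+
  have card: "card J = Suc (card (J - {j}))" by (rule card.remove[OF J j(1)])
  have le: "a + s j - 1 + (\<Sum>j\<in>J - {j}. s j - 1) \<le> n" using n split(1) sj by linarith
  have "cut_count n k (a + s j - 1 + (\<Sum>j\<in>J - {j}. s j - 1)) + int (card (J - {j})) * cut_count n k 1
    \<le> cut_count n k (a + s j - 1) + (\<Sum>j\<in>J - {j}. cut_count n k (s j))"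
  proof (rule cut_sum_collect)
    show "1 \<le> a + s j - 1" using a sj by linarith
    show "1 \<le> s i" if "i \<in> J - {j}" for i using s that by blast
  qed (use J le in simp_all)
  moreover have "cut_count n k 1 + cut_count n k (a + s j - 1) < cut_count n k a + cut_count n k (s j)"
    using a sj le k by (intro cut_exchange) linarith+
  moreover have "a + (\<Sum>j\<in>J. s j - 1) = a + s j - 1 + (\<Sum>j\<in>J - {j}. s j - 1)"
    using sj split(1) by linarith
  ultimately show ?thesis using split(2) card by (simp add: distrib_right)
qed

text \<open>
The least possible sum of the cut counts of \<open>w\<close> branches on a level if their sizes add up to \<open>W\<close> and
two of them have size at least \<open>L\<close>: one branch of size \<open>L\<close>, leaves, and one branch that takes the rest.
\<close>
definition level_min :: "nat \<Rightarrow> nat \<Rightarrow> nat \<Rightarrow> nat \<Rightarrow> nat \<Rightarrow> int" where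
  "level_min n k L w W =
     cut_count n k L + cut_count n k (W - L - (w - 2)) + int (w - 2) * cut_count n k 1"

text \<open>
First the excess of the vertices other than \<open>x\<close> and \<open>y\<close> moves to \<open>x\<close>, which then carries \<open>a\<close>; then
\<open>y\<close> is pushed down to \<open>L\<close>. Equality forces both steps to change nothing. For \<open>L = 1\<close> it need
not: then \<open>x\<close> and \<open>y\<close> may both carry \<open>1\<close> while a third vertex carries the rest.
\<close>
lemma level_bound:
  assumes I: "finite I" and xy: "x \<in> I" "y \<in> I" "x \<noteq> y" and L: "1 \<le> L" "L \<le> s x" "L \<le> s y"
    and s: "\<And>v. v \<in> I \<Longrightarrow> 1 \<le> s v" and n: "(\<Sum>v\<in>I. s v) \<le> n"
  shows "level_min n k L (card I) (\<Sum>v\<in>I. s v) \<le> (\<Sum>v\<in>I. cut_count n k (s v))"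
    and "level_min n k L (card I) (\<Sum>v\<in>I. s v) = (\<Sum>v\<in>I. cut_count n k (s v)) \<Longrightarrow>
      2 \<le> L \<Longrightarrow> 2 \<le> k \<Longrightarrow> k \<le> n - L \<Longrightarrow>
      (s x = L \<or> s y = L) \<and> (\<forall>v\<in>I - {x, y}. s v = 1)"
proof -
  define J where "J = I - {x, y}"
  let ?f = "cut_count n k"
  have J: "finite J" "I = insert x (insert y J)" "x \<notin> insert y J" "y \<notin> J"
    using I xy unfolding J_def by auto
  have card: "card I - 2 = card J" unfolding J(2) using J(1,3,4) by simp
  have sums: "(\<Sum>v\<in>I. s v) = s x + s y + (\<Sum>v\<in>J. s v)"
    "(\<Sum>v\<in>I. ?f (s v)) = ?f (s x) + ?f (s y) + (\<Sum>v\<in>J. ?f (s v))"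
    unfolding J(2) using J(1,3,4) by simp_all
  have sJ: "\<And>v. v \<in> J \<Longrightarrow> 1 \<le> s v" using s unfolding J_def by auto
  have "(\<Sum>v\<in>J. s v) = (\<Sum>v\<in>J. (s v - 1) + 1)" 
  proof (rule sum.cong)
    show "s v = s v - 1 + 1" if "v \<in> J" for v using sJ[OF that] by simp
  qed simp
  then have pred: "(\<Sum>v\<in>J. s v) = (\<Sum>v\<in>J. s v - 1) + card J" by (simp only: sum.distrib card_eq_sum)
  define a where "a = s x + (\<Sum>v\<in>J. s v - 1)"
  have a: "L \<le> a" "a + s y - L \<le> n" "(\<Sum>v\<in>I. s v) - L - card J = a + s y - L"
    using L n sums(1) pred unfolding a_def by linarith+
  have an: "a \<le> n" using a L by linarith
  have lm: "level_min n k L (card I) (\<Sum>v\<in>I. s v) = ?f L + ?f (a + s y - L) + int (card J) * ?f 1"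
    unfolding level_min_def card a(3) ..
  have step1: "?f a + int (card J) * ?f 1 \<le> ?f (s x) + (\<Sum>v\<in>J. ?f (s v))"
    unfolding a_def using J(1) L sJ an[unfolded a_def] by (intro cut_sum_collect) linarith+
  have step2: "?f L + ?f (a + s y - L) \<le> ?f a + ?f (s y)"
    using a L by (intro cut_exchange(1)) auto
  show "level_min n k L (card I) (\<Sum>v\<in>I. s v) \<le> (\<Sum>v\<in>I. ?f (s v))"
    unfolding lm sums(2) using step1 step2 by linarith
  assume eq: "level_min n k L (card I) (\<Sum>v\<in>I. s v) = (\<Sum>v\<in>I. ?f (s v))"
    and L2: "2 \<le> L" and k: "2 \<le> k" "k \<le> n - L"
  then have kn: "k < n" by arith
  have leaves: "s v = 1" if v: "v \<in> J" for v
  proof (rule ccontr)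
    assume "s v \<noteq> 1"
    then have "?f a + int (card J) * ?f 1 < ?f (s x) + (\<Sum>v\<in>J. ?f (s v))"
      unfolding a_def using J(1) L L2 sJ an[unfolded a_def] k(1) kn v
      by (intro cut_sum_collect_strict[where j = v]) linarith+
    then show False using step2 eq unfolding lm sums(2) by linarith
  qed
  then have "a = s x" unfolding a_def by simp
  moreover have "a = L \<or> s y = L"
  proof (rule ccontr)
    assume "\<not> ?thesis"
    then have "?f L + ?f (a + s y - L) < ?f a + ?f (s y)"
      using a L k by (intro cut_exchange(2)) auto
    then show False using step1 eq unfolding lm sums(2) by linarith
  qed
  ultimately show "(s x = L \<or> s y = L) \<and> (\<forall>v\<in>I - {x, y}. s v = 1)"
    using leaves unfolding J_def by auto
qed

section \<open>Trees with levels\<close>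

text \<open>
The vertices of level \<open>0\<close> are the centre, \<open>a\<close> and \<open>b\<close>. If they differ, then they are joined by an edge
of their own and neither counts as the parent of the other, which keeps the two sides interchangeable.
\<close>
definition levelled_graph :: "'a set \<Rightarrow> ('a \<Rightarrow> 'a) \<Rightarrow> ('a \<Rightarrow> nat) \<Rightarrow> 'a \<Rightarrow> 'a \<Rightarrow> 'a ugraph" where
  "levelled_graph V par lev a b = \<lparr> verts = V,
     edges = {{v, par v} | v. v \<in> V \<and> lev v > 0} \<union> (if a = b then {} else {{a, b}}) \<rparr>"

lemma levelled_graph_commute: "levelled_graph V par lev b a = levelled_graph V par lev a b"
  unfolding levelled_graph_def by (auto simp: insert_commute)

text \<open>
All vertices off the spines \<open>x\<close> and \<open>y\<close> are attached to \<open>x\<close>; they are then leaves, and the side of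
\<open>y\<close> is a bare path.
\<close>
definition one_sided :: "'a set \<Rightarrow> ('a \<Rightarrow> 'a) \<Rightarrow> ('a \<Rightarrow> nat) \<Rightarrow> (nat \<Rightarrow> 'a) \<Rightarrow> (nat \<Rightarrow> 'a) \<Rightarrow> bool" where
  "one_sided V par lev x y \<longleftrightarrow>
     (\<forall>v\<in>V. lev v > 0 \<longrightarrow> v \<noteq> x (lev v) \<longrightarrow> v \<noteq> y (lev v) \<longrightarrow> par v = x (lev v - 1))"

text \<open>
A lower bound of \<open>SW\<^sub>k\<close> in terms of the level sizes: the minimum for each positive level and, if
the centre is an edge, the contribution of this edge when one side is as small as it can be.
\<close>
definition level_lower_bound :: "nat \<Rightarrow> nat \<Rightarrow> (nat \<Rightarrow> nat) \<Rightarrow> int" where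
  "level_lower_bound k H w = (let n = \<Sum>i\<le>H. w i in
     (if w 0 = 2 then cut_count n k (Suc H) else 0)
     + (\<Sum>h\<in>{1..H}. level_min n k (Suc H - h) (w h) (\<Sum>i\<in>{h..H}. w i)))"

text \<open>
A tree with its vertices arranged by their distance from the centre. The spines \<open>x\<close> and \<open>y\<close> are the two
halves of a diametral path, read from the centre outwards; they coincide on level \<open>0\<close> exactly if the
diameter is even.
\<close>
locale levelled_tree =
  fixes V :: "'a set" and par :: "'a \<Rightarrow> 'a" and lev :: "'a \<Rightarrow> nat"
    and x y :: "nat \<Rightarrow> 'a" and H :: nat
  assumes finite_V: "finite V"
    and lev_le: "\<And>v. v \<in> V \<Longrightarrow> lev v \<le> H"
    and center: "\<And>v. v \<in> V \<Longrightarrow> lev v = 0 \<Longrightarrow> v = x 0 \<or> v = y 0"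
    and par_in: "\<And>v. v \<in> V \<Longrightarrow> lev v > 0 \<Longrightarrow> par v \<in> V"
    and lev_par: "\<And>v. v \<in> V \<Longrightarrow> lev v > 0 \<Longrightarrow> Suc (lev (par v)) = lev v"
    and x_in: "\<And>h. h \<le> H \<Longrightarrow> x h \<in> V"
    and y_in: "\<And>h. h \<le> H \<Longrightarrow> y h \<in> V"
    and lev_x: "\<And>h. h \<le> H \<Longrightarrow> lev (x h) = h"
    and lev_y: "\<And>h. h \<le> H \<Longrightarrow> lev (y h) = h"
    and par_x: "\<And>h. h < H \<Longrightarrow> par (x (Suc h)) = x h"
    and par_y: "\<And>h. h < H \<Longrightarrow> par (y (Suc h)) = y h"
    and x_neq_y: "\<And>h. 1 \<le> h \<Longrightarrow> h \<le> H \<Longrightarrow> x h \<noteq> y h"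
begin

lemma swapped: "levelled_tree V par lev y x H"
proof
  show "v = y 0 \<or> v = x 0" if "v \<in> V" "lev v = 0" for v using center[OF that] by blast
  show "y h \<noteq> x h" if "1 \<le> h" "h \<le> H" for h using x_neq_y[OF that] by simp
qed (fact finite_V lev_le par_in lev_par x_in y_in lev_x lev_y par_x par_y)+

abbreviation G :: "'a ugraph" where "G \<equiv> levelled_graph V par lev (x 0) (y 0)"

definition to_parent :: "('a \<times> 'a) set" where "to_parent = {(v, par v) | v. v \<in> V \<and> lev v > 0}"

definition branch :: "'a \<Rightarrow> 'a set" where "branch v = {u \<in> V. (u, v) \<in> to_parent\<^sup>*}"

definition level :: "nat \<Rightarrow> 'a set" where "level h = {v \<in> V. lev v = h}"

lemma finite_level: "finite (level h)" unfolding level_def using finite_V by simp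

lemma branch_subset: "branch v \<subseteq> V" unfolding branch_def by auto

lemma finite_branch: "finite (branch v)" using finite_subset[OF branch_subset finite_V] .

lemma self_branch: "v \<in> V \<Longrightarrow> v \<in> branch v" unfolding branch_def by simp

lemma to_parent_lev: "(u, v) \<in> to_parent\<^sup>* \<Longrightarrow> u = v \<or> lev v < lev u"
proof (induction rule: rtrancl_induct)
  case (step v w)
  then have "lev w < lev v" using lev_par unfolding to_parent_def by fastforce
  then show ?case using step by auto
qed simp

lemma branch_child: 
  assumes "v \<in> V" "lev v > 0" "par v \<in> branch w" shows "v \<in> branch w"
  using assms unfolding branch_def by (auto simp: to_parent_def intro: converse_rtrancl_into_rtrancl)

lemma branch_lev: "u \<in> branch v \<Longrightarrow> u = v \<or> lev v < lev u"
  using to_parent_lev unfolding branch_def by auto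

lemma branch_closed:
  assumes "v \<in> X" "\<And>u. u \<in> V \<Longrightarrow> lev u > 0 \<Longrightarrow> par u \<in> X \<Longrightarrow> u \<in> X"
  shows "branch v \<subseteq> X"
proof
  fix u assume "u \<in> branch v"
  then have "(u, v) \<in> to_parent\<^sup>*" unfolding branch_def by simp
  then show "u \<in> X" by (induction rule: converse_rtrancl_induct) (use assms in \<open>auto simp: to_parent_def\<close>)
qed

lemma branch_exists:
  assumes "u \<in> V" "h \<le> lev u" shows "\<exists>v\<in>level h. u \<in> branch v"
  using assms
proof (induction "lev u" arbitrary: u rule: less_induct)
  case less
  show ?case
  proof (cases "lev u = h")
    case True then show ?thesis using less.prems self_branch unfolding level_def by auto
  next
    case False
    then have u: "lev u > 0" "h \<le> lev (par u)" "lev (par u) < lev u"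
      using less.prems lev_par[of u] by auto
    then show ?thesis using less.hyps[OF u(3) par_in u(2)] less.prems branch_child by blast
  qed
qed

lemma branch_unique:
  assumes "u \<in> branch v" "u \<in> branch w" "lev v = lev w" shows "v = w"
proof -
  have "single_valued to_parent" unfolding to_parent_def single_valued_def by auto
  then have "(v, w) \<in> to_parent\<^sup>* \<or> (w, v) \<in> to_parent\<^sup>*"
    using assms single_valued_confluent unfolding branch_def by fastforce
  then show ?thesis using to_parent_lev assms(3) by fastforce
qed

text \<open>
The branches at one level partition the vertices of this and all higher levels.
\<close>
lemma sum_branches: "(\<Sum>v\<in>level h. card (branch v)) = card {u \<in> V. h \<le> lev u}"
proof -
  have "{u \<in> V. h \<le> lev u} = (\<Union>v\<in>level h. branch v)"
    using branch_exists branch_subset branch_lev unfolding level_def by fastforce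
  moreover have "card (\<Union>v\<in>level h. branch v) = (\<Sum>v\<in>level h. card (branch v))"
    using finite_level finite_branch branch_unique unfolding level_def
    by (intro card_UN_disjoint) blast+
  ultimately show ?thesis by simp
qed

lemma card_above: "card {u \<in> V. h \<le> lev u} = (\<Sum>i\<in>{h..H}. card (level i))"
proof -
  have "{u \<in> V. h \<le> lev u} = (\<Union>i\<in>{h..H}. level i)" unfolding level_def using lev_le by auto
  moreover have "card (\<Union>i\<in>{h..H}. level i) = (\<Sum>i\<in>{h..H}. card (level i))"
    using finite_level by (intro card_UN_disjoint) (auto simp: level_def)
  ultimately show ?thesis by simp
qed

lemma card_V: "card V = (\<Sum>i\<le>H. card (level i))"
  using card_above[of 0] by (simp add: atLeast0AtMost)

lemma level_0: "level 0 = {x 0, y 0}"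
  unfolding level_def using center x_in y_in lev_x lev_y by fastforce

lemma x_branch: "h \<le> i \<Longrightarrow> i \<le> H \<Longrightarrow> x i \<in> branch (x h)"
proof (induction rule: dec_induct)
  case base then show ?case using self_branch x_in by auto
next
  case (step i)
  then have "par (x (Suc i)) \<in> branch (x h)" using par_x[of i] by simp
  then show ?case using branch_child[OF x_in[OF step.prems]] lev_x[OF step.prems] by simp
qed

lemma card_x_image: "card (x ` {h..H}) = Suc H - h"
proof -
  have "inj_on x {h..H}" by (rule inj_on_inverseI[where g = lev]) (simp add: lev_x)
  then show ?thesis by (simp add: card_image)
qed

lemma card_branch_x:
  assumes "h \<le> H" shows "Suc H - h \<le> card (branch (x h))"
proof -
  have "card (x ` {h..H}) \<le> card (branch (x h))"
  proof (rule card_mono[OF finite_branch])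
    show "x ` {h..H} \<subseteq> branch (x h)" using x_branch by (intro image_subsetI) simp
  qed
  then show ?thesis unfolding card_x_image .
qed

text \<open>
The branches depend on neither spine, so exchanging the spines yields the statement for \<open>y\<close>.
\<close>
lemmas card_branch_y = levelled_tree.card_branch_x[OF swapped]

lemma card_branch_pos: "v \<in> V \<Longrightarrow> 1 \<le> card (branch v)"
  using card_mono[OF finite_branch[of v], of "{v}"] self_branch[of v] by simp

text \<open>
As a rooted tree the graph has its root at \<open>x 0\<close>. If the centre is an edge, then \<open>y 0\<close> becomes a child of
the root and its branch moves down by one. If the centre is a vertex, then every vertex is in the branch
of \<open>y 0\<close> and \<open>depth\<close> is the level shifted by one.
\<close>
definition rparent :: "'a \<Rightarrow> 'a" where "rparent = par(y 0 := x 0)"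

definition depth :: "'a \<Rightarrow> nat" where
  "depth u = lev u + (if u \<in> branch (y 0) then 1 else 0)"

lemma off_root:
  assumes "v \<in> V" "v \<noteq> x 0"
  obtains "v = y 0" "x 0 \<noteq> y 0" "rparent v = x 0" | "lev v > 0" "v \<noteq> y 0" "rparent v = par v"
proof (cases "v = y 0")
  case True
  then show ?thesis using assms that(1) unfolding rparent_def by simp
next
  case False
  then have "lev v > 0" using center[OF assms(1)] assms(2) by blast
  then show ?thesis using False that(2) unfolding rparent_def by simp
qed

sublocale R: rooted_tree V "x 0" rparent depth
proof
  fix v assume v: "v \<in> V" "v \<noteq> x 0"
  show "rparent v \<in> V" using v
  proof (cases rule: off_root)
    case 1 then show ?thesis using x_in[of 0] by simp
  next
    case 2 then show ?thesis using par_in[OF v(1)] by simp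
  qed
  show "depth (rparent v) < depth v" using v
  proof (cases rule: off_root)
    case 1
    have "x 0 \<notin> branch (y 0)"
      using 1(2) branch_lev[of "x 0" "y 0"] lev_x[of 0] lev_y[of 0] by auto
    then have "depth (x 0) = 0" unfolding depth_def using lev_x[of 0] by simp
    moreover have "depth (y 0) > 0" unfolding depth_def using self_branch[OF y_in[of 0]] by simp
    ultimately show ?thesis using 1 by simp
  next
    case 2
    have "par v \<in> branch (y 0) \<Longrightarrow> v \<in> branch (y 0)" by (rule branch_child[OF v(1) 2(1)])
    moreover have "lev (par v) < lev v" using lev_par[OF v(1) 2(1)] by linarith
    ultimately show ?thesis unfolding 2(3) depth_def by (simp split: if_split)
  qed
qed (fact finite_V, use x_in[of 0] in simp)

lemma rooted_graph: "parent_graph V (x 0) rparent = G"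
proof -
  have "{{v, rparent v} |v. v \<in> V - {x 0}} =
    {{v, par v} |v. v \<in> V \<and> 0 < lev v} \<union> (if x 0 = y 0 then {} else {{x 0, y 0}})" (is "?L = ?R")
  proof (intro subset_antisym subsetI)
    fix e assume "e \<in> ?L"
    then obtain v where v: "v \<in> V" "v \<noteq> x 0" "e = {v, rparent v}" by auto
    from v(1,2) show "e \<in> ?R" by (cases rule: off_root) (use v in auto)
  next
    fix e assume "e \<in> ?R"
    then consider v where "v \<in> V" "0 < lev v" "e = {v, par v}" | "x 0 \<noteq> y 0" "e = {x 0, y 0}"
      by (auto split: if_splits)
    then show "e \<in> ?L"
    proof cases
      case 1
      then have "v \<noteq> x 0" "v \<noteq> y 0" using lev_x[of 0] lev_y[of 0] by auto
      then show ?thesis using 1 unfolding rparent_def by auto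
    next
      case 2
      then have "e = {y 0, rparent (y 0)}" "y 0 \<in> V - {x 0}" using y_in unfolding rparent_def by auto
      then show ?thesis by blast
    qed
  qed
  then show ?thesis unfolding parent_graph_def levelled_graph_def by simp
qed

lemma below_eq_branch:
  assumes "v \<noteq> x 0" shows "R.below v = branch v"
proof -
  have "to_parent \<subseteq> R.up"
  proof
    fix e assume "e \<in> to_parent"
    then obtain v where v: "v \<in> V" "0 < lev v" "e = (v, par v)" unfolding to_parent_def by blast
    then have "v \<noteq> x 0" "rparent v = par v"
      using lev_x[of 0] lev_y[of 0] unfolding rparent_def by auto
    then show "e \<in> R.up" using v unfolding R.up_def by force
  qed
  moreover have "(u, v) \<in> to_parent\<^sup>*" if "(u, v) \<in> R.up\<^sup>*" "v \<noteq> x 0" for u v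
    using that
  proof (induction rule: rtrancl_induct)
    case (step w v)
    then have w: "w \<in> V" "w \<noteq> x 0" "v = rparent w" unfolding R.up_def by auto
    then have "(w, v) \<in> to_parent" using w(1,2)
      by (cases rule: off_root) (use w step in \<open>auto simp: to_parent_def\<close>)
    then show ?case using step w by auto
  qed simp
  ultimately show ?thesis using assms rtrancl_mono unfolding branch_def R.below_def by blast
qed

lemma tree_G: "is_tree G"
  using R.is_tree_G unfolding rooted_graph .

lemma card_level_0: "card (level 0) = (if x 0 = y 0 then 1 else 2)"
  unfolding level_0 by simp

lemma steiner_wiener_levels:
  assumes "k \<ge> 1"
  shows "int (steiner_wiener k G) =
    (if x 0 = y 0 then 0 else cut_count (card V) k (card (branch (y 0))))
    + (\<Sum>h\<in>{1..H}. \<Sum>v\<in>level h. cut_count (card V) k (card (branch v)))"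
proof -
  let ?g = "\<lambda>v. cut_count (card V) k (card (branch v))"
  let ?Y = "if x 0 = y 0 then {} else {y 0}"
  have "V - {x 0} = ?Y \<union> (\<Union>h\<in>{1..H}. level h)"
  proof (intro subset_antisym subsetI)
    fix v assume "v \<in> V - {x 0}"
    then have v: "v \<in> V" "v \<noteq> x 0" by auto
    then show "v \<in> ?Y \<union> (\<Union>h\<in>{1..H}. level h)"
      by (cases rule: off_root) (use v lev_le in \<open>auto simp: level_def Suc_le_eq\<close>)
  next
    fix v assume "v \<in> ?Y \<union> (\<Union>h\<in>{1..H}. level h)"
    then show "v \<in> V - {x 0}" using y_in lev_x[of 0] by (auto simp: level_def split: if_splits)
  qed
  moreover have "?Y \<inter> (\<Union>h\<in>{1..H}. level h) = {}" using lev_y by (auto simp: level_def)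
  ultimately have "sum ?g (V - {x 0}) = sum ?g ?Y + sum ?g (\<Union>h\<in>{1..H}. level h)"
    using finite_level by (simp add: sum.union_disjoint)
  also have "sum ?g (\<Union>h\<in>{1..H}. level h) = (\<Sum>h\<in>{1..H}. sum ?g (level h))"
    using finite_level by (intro sum.UNION_disjoint) (auto simp: level_def)
  also have "sum ?g ?Y = (if x 0 = y 0 then 0 else ?g (y 0))" by simp
  finally show ?thesis
    using R.steiner_wiener_eq[OF assms] unfolding rooted_graph
    by (simp add: below_eq_branch)
qed

abbreviation w :: "nat \<Rightarrow> nat" where "w h \<equiv> card (level h)"

lemma lower_bound_eq:
  "level_lower_bound k H w =
    (if x 0 = y 0 then 0 else cut_count (card V) k (Suc H))
    + (\<Sum>h\<in>{1..H}. level_min (card V) k (Suc H - h) (w h) (\<Sum>v\<in>level h. card (branch v)))"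
  unfolding level_lower_bound_def Let_def sum_branches card_above card_V[symmetric]
  by (simp add: card_level_0)

lemma sum_branches_le: "(\<Sum>v\<in>level h. card (branch v)) \<le> card V"
  unfolding sum_branches using finite_V by (intro card_mono) auto

lemma level_assms:
  assumes h: "h \<in> {1..H}"
  shows "finite (level h)" "x h \<in> level h" "y h \<in> level h" "x h \<noteq> y h" "1 \<le> Suc H - h"
    "Suc H - h \<le> card (branch (x h))" "Suc H - h \<le> card (branch (y h))"
    "\<And>v. v \<in> level h \<Longrightarrow> 1 \<le> card (branch v)" "(\<Sum>v\<in>level h. card (branch v)) \<le> card V"
proof -
  have hH: "1 \<le> h" "h \<le> H" using h by auto
  show "finite (level h)" by (rule finite_level)
  show "x h \<in> level h" "y h \<in> level h"
    unfolding level_def using x_in[OF hH(2)] y_in[OF hH(2)] lev_x[OF hH(2)] lev_y[OF hH(2)] by auto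
  show "x h \<noteq> y h" by (rule x_neq_y[OF hH])
  show "1 \<le> Suc H - h" using hH by simp
  show "Suc H - h \<le> card (branch (x h))" by (rule card_branch_x[OF hH(2)])
  show "Suc H - h \<le> card (branch (y h))" by (rule card_branch_y[OF hH(2)])
  show "1 \<le> card (branch v)" if "v \<in> level h" for v
    using that card_branch_pos[of v] unfolding level_def by blast
  show "(\<Sum>v\<in>level h. card (branch v)) \<le> card V" by (rule sum_branches_le)
qed

lemma level_inequality:
  assumes h: "h \<in> {1..H}"
  shows "level_min (card V) k (Suc H - h) (w h) (\<Sum>v\<in>level h. card (branch v))
    \<le> (\<Sum>v\<in>level h. cut_count (card V) k (card (branch v)))"
  by (rule level_bound(1)[OF level_assms[OF h]])

text \<open>
On the highest level, where \<open>Suc H - h = 1\<close>, the description of the case of equality comes from the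
absence of higher levels and not from concavity.
\<close>
lemma level_equality:
  assumes h: "h \<in> {1..H}"
    and eq: "level_min (card V) k (Suc H - h) (w h) (\<Sum>v\<in>level h. card (branch v))
      = (\<Sum>v\<in>level h. cut_count (card V) k (card (branch v)))"
    and k: "2 \<le> k" "k + H \<le> card V"
  shows "card (branch (x h)) = Suc H - h \<or> card (branch (y h)) = Suc H - h"
    and "v \<in> level h \<Longrightarrow> v \<noteq> x h \<Longrightarrow> v \<noteq> y h \<Longrightarrow> card (branch v) = 1"
proof -
  have "(card (branch (x h)) = Suc H - h \<or> card (branch (y h)) = Suc H - h)
    \<and> (\<forall>v\<in>level h - {x h, y h}. card (branch v) = 1)"
  proof (cases "h = H")
    case True
    have "branch v = {v}" if "v \<in> level h" for v
    proof -
      have v: "v \<in> V" "lev v = H" using that True unfolding level_def by auto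
      have "u = v" if "u \<in> branch v" for u
        using branch_lev[OF that] lev_le[of u] that branch_subset[of v] v(2) by auto
      then show ?thesis using self_branch[OF v(1)] by blast
    qed
    then show ?thesis using True level_assms(2)[OF h] by simp
  next
    case False
    with h k have "2 \<le> Suc H - h" "k \<le> card V - (Suc H - h)" by auto
    then show ?thesis by (intro level_bound(2)[OF level_assms[OF h] eq _ k(1)])
  qed
  then show "card (branch (x h)) = Suc H - h \<or> card (branch (y h)) = Suc H - h"
    and "v \<in> level h \<Longrightarrow> v \<noteq> x h \<Longrightarrow> v \<noteq> y h \<Longrightarrow> card (branch v) = 1" by auto
qed

lemma card_center_branches:
  assumes "x 0 \<noteq> y 0" shows "card (branch (x 0)) + card (branch (y 0)) = card V"
  using sum_branches[of 0] assms unfolding level_0 by simp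

lemma center_inequality:
  assumes ne: "x 0 \<noteq> y 0"
  shows "cut_count (card V) k (Suc H) \<le> cut_count (card V) k (card (branch (y 0)))"
    and "cut_count (card V) k (Suc H) = cut_count (card V) k (card (branch (y 0))) \<Longrightarrow> 2 \<le> k \<Longrightarrow>
      k + Suc H \<le> card V \<Longrightarrow> card (branch (x 0)) = Suc H \<or> card (branch (y 0)) = Suc H"
proof -
  let ?n = "card V" let ?f = "cut_count ?n k"
  let ?a = "card (branch (x 0))" let ?b = "card (branch (y 0))"
  have ab: "?a + ?b = ?n" and L: "Suc H \<le> ?a" "Suc H \<le> ?b"
    using card_center_branches[OF ne] card_branch_x[of 0] card_branch_y[of 0] by auto
  have "?f ?a = ?f ?b" using cut_count_sym[of ?b ?n k] ab by (metis add_diff_cancel_right' le_add2)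
  moreover have "?f (?n - Suc H) = ?f (Suc H)" using L ab by (intro cut_count_sym) simp
  ultimately show "?f (Suc H) \<le> ?f ?b"
    using cut_exchange(1)[of "Suc H" ?a ?b ?n k] L ab by simp
  assume eq: "?f (Suc H) = ?f ?b" and k: "2 \<le> k" "k + Suc H \<le> ?n"
  show "?a = Suc H \<or> ?b = Suc H"
  proof (rule ccontr)
    assume "\<not> ?thesis"
    then have "Suc H < ?a" "Suc H < ?b" "k \<le> ?n - Suc H" using L k by auto
    then show False
      using cut_exchange(2)[of "Suc H" ?a ?b ?n k] L ab k(1) eq
        \<open>?f ?a = ?f ?b\<close> \<open>?f (?n - Suc H) = ?f (Suc H)\<close> by simp
  qed
qed

theorem steiner_wiener_lower:
  assumes "k \<ge> 1"
  shows "level_lower_bound k H w \<le> int (steiner_wiener k G)"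
  unfolding lower_bound_eq steiner_wiener_levels[OF assms]
  using center_inequality(1) level_inequality by (intro add_mono sum_mono) auto

text \<open>
The parent of a vertex off the spines has at least two vertices in its branch, so it lies on a spine.
It cannot be a \<open>y h\<close> with \<open>h \<ge> h0\<close>, because these alone use up the whole size of the branch of \<open>y h0\<close>.
Here \<open>h0\<close> is the lowest level on which the spines are different.
\<close>
lemma one_sidedI:
  assumes h0: "h0 = (if x 0 = y 0 then 1 else 0)" "h0 \<le> H"
    and y: "card (branch (y h0)) = Suc H - h0"
    and leaf: "\<And>h v. h \<in> {1..H} \<Longrightarrow> v \<in> level h \<Longrightarrow> v \<noteq> x h \<Longrightarrow> v \<noteq> y h \<Longrightarrow> card (branch v) = 1"
  shows "one_sided V par lev x y"
  unfolding one_sided_def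
proof (intro ballI impI)
  fix v assume v: "v \<in> V" "lev v > 0" "v \<noteq> x (lev v)" "v \<noteq> y (lev v)"
  define j where "j = lev v - 1"
  let ?u = "par v"
  have j: "lev v = Suc j" "lev ?u = j" "j < H" and u: "?u \<in> V"
    using v lev_par[of v] lev_le[of v] par_in unfolding j_def by auto
  have vu: "v \<in> branch ?u" using v u self_branch branch_child by blast
  have "?u = x j \<or> ?u = y j"
  proof (cases "j = 0")
    case True then show ?thesis using center[OF u] j by simp
  next
    case False
    show ?thesis
    proof (rule ccontr)
      assume "\<not> ?thesis"
      then have "card (branch ?u) = 1" using leaf[of j ?u] False j u unfolding level_def by auto
      moreover have "?u \<noteq> v" using j by (metis n_not_Suc_n)
      then have "card {?u, v} = 2" by simp
      moreover have "card {?u, v} \<le> card (branch ?u)"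
        using vu u self_branch by (intro card_mono finite_branch) auto
      ultimately show False by simp
    qed
  qed
  moreover have False if uy: "?u = y j" "?u \<noteq> x j"
  proof -
    have "h0 \<le> j" using uy h0 by (cases "j = 0") auto
    interpret S: levelled_tree V par lev y x H by (rule swapped)
    have "y j \<in> branch (y h0)" using S.x_branch[OF \<open>h0 \<le> j\<close>] j by simp
    then have "v \<in> branch (y h0)" using branch_child v uy by metis
    moreover have "y ` {h0..H} \<subseteq> branch (y h0)" using S.x_branch by auto
    moreover have "v \<notin> y ` {h0..H}" using v lev_y by auto
    ultimately have "card (insert v (y ` {h0..H})) \<le> card (branch (y h0))"
      by (intro card_mono finite_branch) auto
    then show False using \<open>v \<notin> y ` {h0..H}\<close> S.card_x_image[of h0] y by simp
  qed
  ultimately show "?u = x (lev v - 1)" unfolding j_def by blast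
qed

text \<open>
The bound is a sum of bounds for the levels and the central edge, so equality holds in each of them.
The assumption on \<open>k\<close> is \<open>k \<le> n - r\<close> for the radius \<open>r\<close>: it is \<open>H\<close> or \<open>H + 1\<close>, and the size \<open>L\<close> in
the strict exchanges is at most \<open>r\<close>.
\<close>
theorem steiner_wiener_equality:
  assumes k: "2 \<le> k" "k + (H + w 0 - 1) \<le> card V" and big: "card V > 1"
    and eq: "int (steiner_wiener k G) = level_lower_bound k H w"
  shows "one_sided V par lev x y \<or> one_sided V par lev y x"
proof -
  interpret S: levelled_tree V par lev y x H by (rule swapped)
  let ?f = "cut_count (card V) k"
  let ?A = "\<lambda>h. level_min (card V) k (Suc H - h) (w h) (\<Sum>v\<in>level h. card (branch v))"
  let ?B = "\<lambda>h. \<Sum>v\<in>level h. ?f (card (branch v))"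
  let ?a = "if x 0 = y 0 then 0 else ?f (Suc H)"
  let ?b = "if x 0 = y 0 then 0 else ?f (card (branch (y 0)))"
  have ab: "?a \<le> ?b" using center_inequality(1) by auto
  have AB: "?A h \<le> ?B h" if "h \<in> {1..H}" for h using level_inequality[OF that] .
  have k1: "1 \<le> k" using k(1) by simp
  have "?a + sum ?A {1..H} = ?b + sum ?B {1..H}"
    using eq[symmetric] unfolding steiner_wiener_levels[OF k1] lower_bound_eq .
  moreover have "sum ?A {1..H} \<le> sum ?B {1..H}" using AB by (rule sum_mono)
  ultimately have eqs: "?a = ?b" "sum ?A {1..H} = sum ?B {1..H}" using ab by linarith+
  have eqAB: "?A h = ?B h" if "h \<in> {1..H}" for h
    by (rule sum_mono_inv[OF eqs(2) AB that]) simp_all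
  have "w 0 \<ge> 1" unfolding card_level_0 by simp
  then have kH: "k + H \<le> card V" using k(2) by linarith
  have leaf: "card (branch v) = 1" if "h \<in> {1..H}" "v \<in> level h" "v \<noteq> x h" "v \<noteq> y h" for h v
    using level_equality(2)[OF that(1) eqAB[OF that(1)] k(1) kH] that by blast
  define h0 :: nat where "h0 = (if x 0 = y 0 then 1 else 0)"
  have h0H: "h0 \<le> H"
  proof (rule ccontr)
    assume "\<not> ?thesis"
    then have "H = 0" "x 0 = y 0" unfolding h0_def by (auto split: if_splits)
    then show False using big card_V card_level_0 by simp
  qed
  have "card (branch (x h0)) = Suc H - h0 \<or> card (branch (y h0)) = Suc H - h0"
  proof (cases "x 0 = y 0")
    case True
    then have "h0 = 1" "h0 \<in> {1..H}" using h0H unfolding h0_def by auto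
    then show ?thesis using level_equality(1)[OF _ eqAB k(1) kH, of h0] by blast
  next
    case False
    then have "w 0 = 2" using card_level_0 by simp
    then show ?thesis using center_inequality(2)[OF False _ k(1)] eqs(1) k(2)
      unfolding h0_def by (simp add: False)
  qed
  then show ?thesis
  proof
    assume "card (branch (y h0)) = Suc H - h0"
    then show ?thesis using one_sidedI[OF h0_def h0H] leaf by blast
  next
    assume "card (branch (x h0)) = Suc H - h0"
    moreover have "h0 = (if y 0 = x 0 then 1 else 0)" unfolding h0_def by auto
    ultimately show ?thesis using S.one_sidedI[OF _ h0H] leaf by blast
  qed
qed

lemma one_sided_branches:
  assumes os: "one_sided V par lev x y"
  shows "v \<in> V \<Longrightarrow> v \<noteq> x (lev v) \<Longrightarrow> v \<noteq> y (lev v) \<Longrightarrow> branch v = {v}"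
    and "h \<le> H \<Longrightarrow> x h \<noteq> y h \<Longrightarrow> card (branch (y h)) = Suc H - h"
proof -
  have par_cases: "par u = x (lev (par u)) \<or> u = y (lev u)" "Suc (lev (par u)) = lev u" "lev u \<le> H"
    if "u \<in> V" "lev u > 0" for u
  proof -
    from lev_par[OF that] show *: "Suc (lev (par u)) = lev u" .
    show le: "lev u \<le> H" using lev_le that by simp
    show "par u = x (lev (par u)) \<or> u = y (lev u)"
    proof (cases "u = x (lev u)")
      case True
      then have "par u = x (lev (par u))" using par_x[of "lev (par u)"] * le by (metis Suc_le_lessD)
      then show ?thesis by simp
    next
      case False
      then have "u = y (lev u) \<or> par u = x (lev u - 1)" using os that unfolding one_sided_def by blast
      then show ?thesis using * by (metis diff_Suc_1)
    qed
  qed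
  show "branch v = {v}" if v: "v \<in> V" "v \<noteq> x (lev v)" "v \<noteq> y (lev v)"
  proof -
    have "branch v \<subseteq> {v}"
    proof (rule branch_closed)
      fix u assume u: "u \<in> V" "0 < lev u" "par u \<in> {v}"
      then have "u = y (lev u)" using par_cases[OF u(1,2)] v by auto
      then have "par u = y (lev (par u))" using par_y[of "lev (par u)"] par_cases[OF u(1,2)]
        by (metis Suc_le_lessD)
      then show "u \<in> {v}" using u v by auto
    qed simp
    then show ?thesis using self_branch[OF v(1)] by auto
  qed
  show "card (branch (y h)) = Suc H - h" if h: "h \<le> H" "x h \<noteq> y h"
  proof -
    interpret S: levelled_tree V par lev y x H by (rule swapped)
    have "branch (y h) \<subseteq> y ` {h..H}"
    proof (rule branch_closed)
      fix u assume u: "u \<in> V" "0 < lev u" "par u \<in> y ` {h..H}"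
      then obtain i where i: "par u = y i" "h \<le> i" "i \<le> H" by auto
      then have li: "lev (par u) = i" using lev_y by simp
      have "x i \<noteq> y i" using h i x_neq_y[of i] by (cases "i = 0") auto
      then have "u = y (lev u)" "lev u \<in> {h..H}" using par_cases[OF u(1,2)] i li by auto
      then show "u \<in> y ` {h..H}" by blast
    qed (use h in auto)
    then have "card (branch (y h)) \<le> card (y ` {h..H})" by (intro card_mono) auto
    then show ?thesis using S.card_x_image card_branch_y[OF h(1)] by simp
  qed
qed

theorem steiner_wiener_one_sided:
  assumes os: "one_sided V par lev x y" and k: "k \<ge> 1"
  shows "int (steiner_wiener k G) = level_lower_bound k H w"
proof -
  let ?f = "cut_count (card V) k"
  have "(\<Sum>v\<in>level h. ?f (card (branch v)))
    = level_min (card V) k (Suc H - h) (w h) (\<Sum>v\<in>level h. card (branch v))" if h: "h \<in> {1..H}" for h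
  proof -
    define J where "J = level h - {x h, y h}"
    have ne: "x h \<noteq> y h" using x_neq_y h by simp
    have "x h \<in> level h" "y h \<in> level h" using h x_in y_in lev_x lev_y unfolding level_def by auto
    then have J: "level h = insert x' (insert y' J)" "finite J" "x' \<notin> insert y' J" "y' \<notin> J"
      if "x' = x h" "y' = y h" for x' y'
      using finite_level ne that unfolding J_def by auto
    note J = J[OF refl refl]
    have leaf: "card (branch v) = 1" if "v \<in> J" for v
    proof -
      have "v \<in> V" "v \<noteq> x (lev v)" "v \<noteq> y (lev v)" using that unfolding J_def level_def by auto
      then show ?thesis using one_sided_branches(1)[OF os] by simp
    qed
    have y: "card (branch (y h)) = Suc H - h" using one_sided_branches(2)[OF os _ ne] h by simp
    have "(\<Sum>v\<in>level h. card (branch v)) = card (branch (x h)) + (Suc H - h) + card J"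
      unfolding J(1) using J(2-4) leaf y by simp
    moreover have "(\<Sum>v\<in>level h. ?f (card (branch v))) = ?f (card (branch (x h))) + ?f (Suc H - h) + int (card J) * ?f 1"
      unfolding J(1) using J(2-4) leaf y by simp
    moreover have "w h - 2 = card J" unfolding J(1) using J(2-4) by simp
    ultimately show ?thesis unfolding level_min_def by simp
  qed
  moreover have "card (branch (y 0)) = Suc H" if "x 0 \<noteq> y 0"
    using one_sided_branches(2)[OF os _ that] by simp
  ultimately show ?thesis unfolding lower_bound_eq steiner_wiener_levels[OF k] by simp
qed

end

section \<open>Isomorphism of one-sided trees\<close>

text \<open>
Map spine to spine and, level by level, the remaining vertices to the remaining vertices, of which
there are equally many. Parents are preserved because the parent of a remaining vertex lies on the first
spine.
\<close>
theorem one_sided_isomorphic: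
  assumes A: "levelled_tree V par lev x y H" "one_sided V par lev x y"
    and B: "levelled_tree V' par' lev' x' y' H" "one_sided V' par' lev' x' y'"
    and cards: "\<And>h. h \<le> H \<Longrightarrow>
      card (levelled_tree.level V lev h) = card (levelled_tree.level V' lev' h)"
  shows "isomorphic (levelled_graph V par lev (x 0) (y 0)) (levelled_graph V' par' lev' (x' 0) (y' 0))"
proof -
  interpret A: levelled_tree V par lev x y H by (rule A(1))
  interpret B: levelled_tree V' par' lev' x' y' H by (rule B(1))
  have center_iff: "x 0 = y 0 \<longleftrightarrow> x' 0 = y' 0"
    using cards[OF le0] unfolding A.card_level_0 B.card_level_0 by (cases "x 0 = y 0") (simp_all split: if_splits)
  define off where "off h = A.level h - {x h, y h}" for h
  define off' where "off' h = B.level h - {x' h, y' h}" for h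
  have "\<exists>\<phi>. bij_betw \<phi> (off h) (off' h)" if h: "h \<in> {1..H}" for h
  proof (rule finite_same_card_bij)
    have "card (off h) = A.w h - 2"
      unfolding off_def using A.level_assms(1-4)[OF h] by (subst card_Diff_subset) auto
    moreover have "card (off' h) = B.w h - 2"
      unfolding off'_def using B.level_assms(1-4)[OF h] by (subst card_Diff_subset) auto
    ultimately show "card (off h) = card (off' h)" using cards[of h] h by simp
  qed (simp_all add: off_def off'_def A.finite_level B.finite_level)
  then have "\<forall>h\<in>{1..H}. \<exists>\<phi>. bij_betw \<phi> (off h) (off' h)" by blast
  from bchoice[OF this] obtain \<phi> where
    \<phi>: "\<And>h. h \<in> {1..H} \<Longrightarrow> bij_betw (\<phi> h) (off h) (off' h)" by blast
  define f where "f v = (if v = x (lev v) then x' (lev v)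
    else if v = y (lev v) then y' (lev v) else \<phi> (lev v) v)" for v
  \<comment> \<open>A vertex of level \<open>0\<close> lies on a spine, so \<open>\<phi>\<close> is needed on positive levels only.\<close>
  have off: "v \<in> off (lev v)" "lev v \<in> {1..H}" if "v \<in> V" "v \<noteq> x (lev v)" "v \<noteq> y (lev v)" for v
  proof -
    show "v \<in> off (lev v)" using that unfolding off_def A.level_def by simp
    have "lev v \<noteq> 0" using A.center[OF that(1)] that(2,3) by metis
    then show "lev v \<in> {1..H}" using A.lev_le[OF that(1)] by auto
  qed
  have f_off: "f v \<in> off' (lev v)" if "v \<in> V" "v \<noteq> x (lev v)" "v \<noteq> y (lev v)" for v
    using bij_betwE[OF \<phi>[OF off(2)[OF that]]] off(1)[OF that] that(2,3) unfolding f_def by simp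
  have fx: "f (x h) = x' h" if "h \<le> H" for h
    unfolding f_def using A.lev_x[OF that] by simp
  have xy: "x h = y h \<longleftrightarrow> x' h = y' h" if "h \<le> H" for h
  proof (cases "h = 0")
    case True then show ?thesis using center_iff by simp
  next
    case False
    then show ?thesis using A.x_neq_y[OF _ that] B.x_neq_y[OF _ that] by simp
  qed
  have fy: "f (y h) = y' h" if "h \<le> H" for h
  proof (cases "y h = x h")
    case True
    then have "x' h = y' h" using xy[OF that] by metis
    then show ?thesis using fx[OF that] True by metis
  next
    case False
    then show ?thesis unfolding f_def A.lev_y[OF that] by simp
  qed

  have f_level: "f v \<in> V' \<and> lev' (f v) = lev v" if v: "v \<in> V" for v
  proof -
    have h: "lev v \<le> H" using A.lev_le[OF v] .
    consider "v = x (lev v)" | "v = y (lev v)" | "v \<noteq> x (lev v)" "v \<noteq> y (lev v)" by blast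
    then show ?thesis
    proof cases
      case 1
      then have "f v = x' (lev v)" using fx[OF h] by simp
      then show ?thesis using B.x_in[OF h] B.lev_x[OF h] by simp
    next
      case 2
      then have "f v = y' (lev v)" using fy[OF h] by simp
      then show ?thesis using B.y_in[OF h] B.lev_y[OF h] by simp
    next
      case 3
      then show ?thesis using f_off[OF v 3] unfolding off'_def B.level_def by simp
    qed
  qed
  have inj: "inj_on f V"
  proof (rule inj_onI)
    fix u v assume u: "u \<in> V" and v: "v \<in> V" and eq: "f u = f v"
    define h where "h = lev v"
    have lu: "lev u = h" and lv: "lev v = h" using f_level[OF u] f_level[OF v] eq h_def by auto
    have h: "h \<le> H" using A.lev_le[OF v] lv by simp
    have cases: "(w = x h \<and> f w = x' h) \<or> (w = y h \<and> f w = y' h) \<or>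
        (w \<in> off h \<and> f w = \<phi> h w \<and> f w \<in> off' h \<and> h \<in> {1..H})"
      if w: "w \<in> V" "lev w = h" for w
    proof -
      consider "w = x h" | "w = y h" | "w \<noteq> x h" "w \<noteq> y h" by blast
      then show ?thesis
      proof cases
        case 1 then show ?thesis using fx[OF h] by simp
      next
        case 2 then show ?thesis using fy[OF h] by simp
      next
        case 3
        then have "w \<noteq> x (lev w)" "w \<noteq> y (lev w)" using w by auto
        from off[OF w(1) this] f_off[OF w(1) this] show ?thesis
          using 3 w(2) unfolding f_def by simp
      qed
    qed
    have inj\<phi>: "inj_on (\<phi> h) (off h)" if "h \<in> {1..H}" using \<phi>[OF that] by (rule bij_betw_imp_inj_on)
    have "x' h \<notin> off' h" "y' h \<notin> off' h" unfolding off'_def by auto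
    then consider "f u = x' h" "u = x h \<or> (u = y h \<and> x' h = y' h)" "v = x h \<or> (v = y h \<and> x' h = y' h)"
      | "f u = y' h" "u = y h \<or> (u = x h \<and> x' h = y' h)" "v = y h \<or> (v = x h \<and> x' h = y' h)"
      | "u \<in> off h" "v \<in> off h" "\<phi> h u = \<phi> h v" "h \<in> {1..H}"
      using cases[OF u lu] cases[OF v lv] eq by metis
    then show "u = v"
    proof cases
      case 1 then show ?thesis using xy[OF h] by metis
    next
      case 2 then show ?thesis using xy[OF h] by metis
    next
      case 3 then show ?thesis using inj\<phi> by (meson inj_onD)
    qed
  qed
  have fV: "f ` V = V'"
  proof (rule card_subset_eq[OF B.finite_V])
    show "f ` V \<subseteq> V'" using f_level by auto
    show "card (f ` V) = card V'"
      unfolding card_image[OF inj] A.card_V B.card_V using cards by (intro sum.cong) auto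
  qed
  have f_par: "par' (f v) = f (par v)" if v: "v \<in> V" "lev v > 0" for v
  proof -
    obtain j where j: "lev v = Suc j" using v(2) by (cases "lev v") auto
    have jH: "j < H" "j \<le> H" using A.lev_le[OF v(1)] j by auto
    consider "v = x (Suc j)" | "v = y (Suc j)" | "v \<noteq> x (lev v)" "v \<noteq> y (lev v)" using j by metis
    then show ?thesis
    proof cases
      case 1
      then show ?thesis using jH fx[of "Suc j"] fx[of j] A.par_x[of j] B.par_x[of j] by simp
    next
      case 2
      then show ?thesis using jH fy[of "Suc j"] fy[of j] A.par_y[of j] B.par_y[of j] by simp
    next
      case 3
      have "par v = x j" using A(2) v 3 j unfolding one_sided_def by fastforce
      moreover have fv: "f v \<in> V'" "lev' (f v) = Suc j" "f v \<noteq> x' (Suc j)" "f v \<noteq> y' (Suc j)"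
        using f_off[OF v(1) 3] j unfolding off'_def B.level_def by auto
      then have "par' (f v) = x' j" using B(2) unfolding one_sided_def by fastforce
      ultimately show ?thesis using fx[OF jH(2)] by simp
    qed
  qed
  have edges: "edges B.G = (`) f ` edges A.G"
  proof -
    have "{{v, par' v} | v. v \<in> V' \<and> lev' v > 0} = (`) f ` {{v, par v} | v. v \<in> V \<and> lev v > 0}"
    proof (intro subset_antisym subsetI)
      fix e assume "e \<in> {{v, par' v} | v. v \<in> V' \<and> lev' v > 0}"
      then obtain v where v: "v \<in> V" "lev v > 0" "e = {f v, par' (f v)}" using fV f_level by auto
      then have "e = f ` {v, par v}" using f_par by simp
      then show "e \<in> (`) f ` {{v, par v} | v. v \<in> V \<and> lev v > 0}" using v by blast
    next
      fix e assume "e \<in> (`) f ` {{v, par v} | v. v \<in> V \<and> lev v > 0}"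
      then obtain v where v: "v \<in> V" "lev v > 0" "e = f ` {v, par v}" by auto
      then have "e = {f v, par' (f v)}" using f_par by simp
      moreover have "f v \<in> V'" "lev' (f v) > 0" using f_level[OF v(1)] v(2) by auto
      ultimately show "e \<in> {{v, par' v} | v. v \<in> V' \<and> lev' v > 0}" by blast
    qed
    moreover have "(if x' 0 = y' 0 then {} else {{x' 0, y' 0}})
        = (`) f ` (if x 0 = y 0 then {} else {{x 0, y 0}})"
      using center_iff fx[of 0] fy[of 0] by simp
    ultimately show ?thesis unfolding levelled_graph_def by (simp add: image_Un)
  qed
  have edge_iff: "{u, v} \<in> edges A.G \<longleftrightarrow> {f u, f v} \<in> edges B.G" if "u \<in> V" "v \<in> V" for u v
  proof
    assume "{u, v} \<in> edges A.G"
    then have "f ` {u, v} \<in> edges B.G" unfolding edges by (rule imageI)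
    then show "{f u, f v} \<in> edges B.G" by simp
  next
    assume "{f u, f v} \<in> edges B.G"
    then obtain e where e: "e \<in> edges A.G" "f ` {u, v} = f ` e" unfolding edges by auto
    have "e \<subseteq> V" using e(1) A.tree_G unfolding is_tree_def simple_graph_def levelled_graph_def by auto
    then have "{u, v} = e" using e(2) inj_on_image_eq_iff[OF inj, of "{u, v}" e] that by blast
    then show "{u, v} \<in> edges A.G" using e by simp
  qed
  have "bij_betw f V V'" using inj fV unfolding bij_betw_def by blast
  then show ?thesis unfolding isomorphic_def using edge_iff
    by (intro exI[of _ f]) (auto simp: levelled_graph_def)
qed

section \<open>The centred structure of a tree\<close>

lemma joined_Suc_last:
  assumes "joined G (Suc m) u v"
  shows "\<exists>w. joined G m u w \<and> {w, v} \<in> edges G"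
proof -
  obtain p where p: "walk_between G u p v" "length p = Suc (Suc m)"
    using assms unfolding joined_def by blast
  obtain q v' where "p = q @ [v']" using p(2) by (cases p rule: rev_cases) auto
  then have q: "p = q @ [v]" "q \<noteq> []" using p unfolding walk_between_def by auto
  have "walk_between G u q (last q)" "{last q, v} \<in> edges G"
    using p(1) q(2) unfolding q(1) walk_between_def walk_def by (auto simp: successively_append_iff)
  moreover have "length q = Suc m" using p(2) q(1) by simp
  ultimately show ?thesis unfolding joined_def by blast
qed

text \<open>
The parent of \<open>v\<close> is the last vertex before \<open>v\<close> on a shortest walk from \<open>c\<close>.
\<close>
lemma tree_as_parent_graph:
  assumes T: "is_tree T" and c: "c \<in> verts T"
  shows "\<exists>p. rooted_tree (verts T) c p (distance T c) \<and> parent_graph (verts T) c p = T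
    \<and> (\<forall>v\<in>verts T - {c}. distance T c v = Suc (distance T c (p v)))"
proof -
  have conn: "connected_graph T" and fin: "finite (verts T)"
    and simple: "\<And>e. e \<in> edges T \<Longrightarrow> e \<subseteq> verts T \<and> card e = 2"
    using T by (simp_all add: is_tree_def simple_graph_def)
  have "\<exists>u. u \<in> verts T \<and> {u, v} \<in> edges T \<and> distance T c v = Suc (distance T c u)"
    if v: "v \<in> verts T - {c}" for v
  proof -
    obtain m where m: "distance T c v = Suc m"
    proof -
      have "distance T c v > 0" using distance_pos[OF conn c, of v] v by blast
      then show thesis using that by (auto simp: gr0_conv_Suc)
    qed
    moreover have "v \<in> verts T" using v by blast
    ultimately have "joined T (Suc m) c v" using connected_joined[OF conn c, of v] by metis
    then obtain u where u: "joined T m c u" "{u, v} \<in> edges T"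
      using joined_Suc_last[of T m c v] by blast
    have uV: "u \<in> verts T" using joined_in_verts[OF u(1)] by simp
    have "distance T c v \<le> distance T c u + 1"
      by (intro distance_le joined_trans[OF connected_joined[OF conn c uV]] joined_edge[OF u(2) uV])
        (use v in blast)
    then have "distance T c v = Suc (distance T c u)" using m distance_le[OF u(1)] by linarith
    then show ?thesis using uV u(2) by blast
  qed
  then have "\<forall>v\<in>verts T - {c}. \<exists>u. u \<in> verts T \<and> {u, v} \<in> edges T
      \<and> distance T c v = Suc (distance T c u)" by blast
  from bchoice[OF this] obtain p where p0: "\<forall>v\<in>verts T - {c}.
      p v \<in> verts T \<and> {p v, v} \<in> edges T \<and> distance T c v = Suc (distance T c (p v))" ..
  note p = p0[rule_format]
  interpret R: rooted_tree "verts T" c p "distance T c"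
  proof
    fix v assume v: "v \<in> verts T" "v \<noteq> c"
    then have v': "v \<in> verts T - {c}" by simp
    show "p v \<in> verts T" "distance T c (p v) < distance T c v" using p[OF v'] by simp_all
  qed (fact fin c)+
  have sub: "edges R.G \<subseteq> edges T"
    unfolding R.edges_G using p by (auto simp: insert_commute)
  have "edges T \<subseteq> edges R.G"
  proof (rule ccontr)
    assume "\<not> ?thesis"
    then obtain e where e: "e \<in> edges T" "e \<notin> edges R.G" by blast
    obtain u v where uv: "e = {u, v}" "u \<noteq> v" using simple[OF e(1)] by (auto simp: card_2_iff)
    have uvV: "u \<in> verts T" "v \<in> verts T" using simple[OF e(1)] uv by auto
    obtain q0 where q0: "walk_between R.G u q0 v"
      using R.connected_G uvV unfolding connected_graph_def R.verts_G by blast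
    obtain q where q: "walk_between R.G u q v" "distinct q"
      using walk_between_distinct[OF q0] by blast
    \<comment> \<open>An edge outside the parent graph closes a path of the parent graph to a cycle.\<close>
    have "length q \<ge> 3"
    proof (rule ccontr)
      assume "\<not> ?thesis"
      then have "length q = 0 \<or> length q = Suc 0 \<or> length q = Suc (Suc 0)" by linarith
      then consider "q = []" | a where "q = [a]" | a b where "q = [a, b]"
        by (auto simp: length_Suc_conv)
      then show False
      proof cases
        case 1 then show ?thesis using q(1) by (simp add: walk_between_def walk_def)
      next
        case 2 then show ?thesis using q(1) uv(2) by (auto simp: walk_between_def)
      next
        case 3
        then have "{u, v} \<in> edges R.G" using q(1) unfolding walk_between_def walk_def by auto
        then show ?thesis using e(2) uv(1) by simp
      qed
    qed
    moreover have "walk T q"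
    proof -
      have "successively (\<lambda>u v. {u, v} \<in> edges R.G) q" "q \<noteq> []" "set q \<subseteq> verts T"
        using q(1) unfolding walk_between_def walk_def by simp_all
      moreover from this(1) have "successively (\<lambda>u v. {u, v} \<in> edges T) q"
        by (rule successively_mono) (use sub in blast)
      ultimately show ?thesis unfolding walk_def by blast
    qed
    moreover have "{last q, hd q} \<in> edges T"
      using q(1) e(1) uv(1) unfolding walk_between_def by (simp add: insert_commute)
    ultimately have "is_cycle T q" using q(2) unfolding is_cycle_def by blast
    then show False using T unfolding is_tree_def by blast
  qed
  with sub have "edges R.G = edges T" by blast
  then have "R.G = T" by simp
  moreover have "\<forall>v\<in>verts T - {c}. distance T c v = Suc (distance T c (p v))" using p by blast
  ultimately show ?thesis using R.rooted_tree_axioms by blast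
qed

context rooted_tree
begin

lemma distance_leaving:
  assumes u: "u \<in> below v" and w: "w \<in> V" "w \<notin> below v"
  shows "distance G u w = distance G u (p v) + distance G (p v) w"
    and "distance G u w = distance G u v + distance G v w"
proof -
  have V: "u \<in> verts G" "w \<in> verts G" using u w below_subset by auto
  have "v \<in> set q \<and> p v \<in> set q" if "walk_between G u q w" for q
  proof -
    from walk_crosses[OF that u w(2)] obtain a b where
      ab: "a \<in> below v" "b \<notin> below v" "{a, b} \<in> edges G" "a \<in> set q" "b \<in> set q" by blast
    from crossing_edge[OF ab(3,1,2)] ab show ?thesis by simp
  qed
  then show "distance G u w = distance G u (p v) + distance G (p v) w"
    "distance G u w = distance G u v + distance G v w"
    using distance_through[OF connected_G V] by blast+
qed

end

lemma joined_along_walk: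
  assumes "walk_between G a q b" "i \<le> j" "j < length q"
  shows "joined G (j - i) (q ! i) (q ! j)"
  using assms(2,3)
proof (induction j rule: dec_induct)
  case base
  then have "q ! i \<in> verts G" using assms(1) nth_mem unfolding walk_between_def walk_def by blast
  then show ?case using joined_refl by simp
next
  case (step j)
  have "q ! j \<in> verts G" "q ! Suc j \<in> verts G"
    using assms(1) nth_mem[of j q] nth_mem[of "Suc j" q] step.prems
    unfolding walk_between_def walk_def by auto
  moreover have "{q ! j, q ! Suc j} \<in> edges G"
    using assms(1) step.prems unfolding walk_between_def walk_def by (simp add: successively_conv_nth)
  ultimately have step1: "joined G 1 (q ! j) (q ! Suc j)" by (intro joined_edge)
  have "joined G (j - i) (q ! i) (q ! j)" using step.IH step.prems by simp
  then have "joined G (j - i + 1) (q ! i) (q ! Suc j)" using step1 by (rule joined_trans)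
  moreover have "j - i + 1 = Suc j - i" using step.hyps by simp
  ultimately show ?case by simp
qed

text \<open>
A shortest walk between two vertices at maximal distance is shortest between any two of its vertices.
\<close>
lemma diametral_walk:
  assumes conn: "connected_graph T" and fin: "finite (verts T)"
  shows "\<exists>q. length q = Suc (diameter T) \<and> set q \<subseteq> verts T
    \<and> (\<forall>i j. i \<le> j \<longrightarrow> j \<le> diameter T \<longrightarrow> distance T (q ! i) (q ! j) = j - i)
    \<and> (\<forall>i < diameter T. {q ! i, q ! Suc i} \<in> edges T)"
    and "u \<in> verts T \<Longrightarrow> v \<in> verts T \<Longrightarrow> distance T u v \<le> diameter T"
proof -
  let ?V = "verts T"
  have ne: "?V \<noteq> {}" using conn unfolding connected_graph_def by simp
  have ecc: "distance T u v \<le> eccentricity T u" if "v \<in> ?V" for u v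
    unfolding eccentricity_def using fin that by (intro Max_ge) auto
  have ecc_d: "eccentricity T u \<le> diameter T" if "u \<in> ?V" for u
    unfolding diameter_def using fin that by (intro Max_ge) auto
  show dd: "distance T u v \<le> diameter T" if "u \<in> ?V" "v \<in> ?V" for u v
    using ecc[OF that(2), of u] ecc_d[OF that(1)] by linarith
  have "diameter T \<in> eccentricity T ` ?V"
    unfolding diameter_def using fin ne by (intro Max_in) auto
  then obtain a where a: "a \<in> ?V" "diameter T = eccentricity T a" by auto
  have "eccentricity T a \<in> distance T a ` ?V"
    unfolding eccentricity_def using fin ne by (intro Max_in) auto
  then obtain b where b: "b \<in> ?V" "diameter T = distance T a b" using a by auto
  obtain q where q: "walk_between T a q b" "length q = Suc (diameter T)"
    using connected_joined[OF conn a(1) b(1)] unfolding joined_def b(2) by auto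
  have qV: "set q \<subseteq> ?V" "q \<noteq> []" using q(1) unfolding walk_between_def walk_def by auto
  have ends: "q ! 0 = a" "q ! diameter T = b"
    using q qV(2) unfolding walk_between_def by (auto simp: hd_conv_nth last_conv_nth)
  have in_V: "q ! i \<in> ?V" if "i \<le> diameter T" for i using that q(2) qV(1) nth_mem[of i q] by auto
  have "distance T (q ! i) (q ! j) = j - i" if ij: "i \<le> j" "j \<le> diameter T" for i j
  proof -
    let ?d = "distance T"
    have up: "?d (q ! i') (q ! j') \<le> j' - i'" if "i' \<le> j'" "j' \<le> diameter T" for i' j'
      using that q(2) by (intro distance_le joined_along_walk[OF q(1)]) auto
    have V: "q ! 0 \<in> ?V" "q ! i \<in> ?V" "q ! j \<in> ?V" "q ! diameter T \<in> ?V" using in_V ij by auto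
    have "diameter T \<le> ?d (q ! 0) (q ! i) + ?d (q ! i) (q ! diameter T)"
      using distance_triangle[OF conn V(1,2,4)] b(2) ends by simp
    also have "?d (q ! i) (q ! diameter T) \<le> ?d (q ! i) (q ! j) + ?d (q ! j) (q ! diameter T)"
      by (rule distance_triangle[OF conn V(2,3,4)])
    finally have "diameter T \<le> ?d (q ! 0) (q ! i) + (?d (q ! i) (q ! j) + ?d (q ! j) (q ! diameter T))"
      by simp
    then show ?thesis using up[of 0 i] up[of i j] up[of j "diameter T"] ij by linarith
  qed
  moreover have "{q ! i, q ! Suc i} \<in> edges T" if "i < diameter T" for i
    using q(1) q(2) that unfolding walk_between_def walk_def by (simp add: successively_conv_nth)
  ultimately show "\<exists>q. length q = Suc (diameter T) \<and> set q \<subseteq> ?V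
    \<and> (\<forall>i j. i \<le> j \<longrightarrow> j \<le> diameter T \<longrightarrow> distance T (q ! i) (q ! j) = j - i)
    \<and> (\<forall>i < diameter T. {q ! i, q ! Suc i} \<in> edges T)"
    using q(2) qV(1) by blast
qed

text \<open>
Let \<open>q\<close> be a diametral walk of length \<open>D\<close>, \<open>c\<close> its vertex number \<open>H = D div 2\<close>, and \<open>y'\<close> the next
vertex. One end of \<open>q\<close> lies in the branch \<open>?B\<close> of \<open>y'\<close> and the other does not. A walk from \<open>u\<close> to
the end on the other side passes through \<open>c\<close>, hence the diameter bounds the distance of \<open>u\<close> from \<open>c\<close>,
and this end is a vertex farthest from \<open>u\<close>. The eccentricity of \<open>u\<close> is thus its distance from \<open>c\<close> plus \<open>H\<close>
in the branch of \<open>y'\<close>, and plus \<open>r = D - H\<close> elsewhere.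
\<close>
theorem tree_levels:
  assumes T: "is_tree T" and big: "card (verts T) > 1"
  shows "\<exists>r H par lev x y. levelled_tree (verts T) par lev x y H
    \<and> levelled_graph (verts T) par lev (x 0) (y 0) = T
    \<and> (\<forall>v\<in>verts T. eccentricity T v = r + lev v)
    \<and> diameter T = r + H \<and> r = (if x 0 = y 0 then H else Suc H)"
proof -
  let ?V = "verts T" let ?d = "distance T"
  define D where "D = diameter T"
  have conn: "connected_graph T" and fin: "finite ?V"
    using T by (simp_all add: is_tree_def simple_graph_def)
  have dD: "?d u v \<le> D" if "u \<in> ?V" "v \<in> ?V" for u v
    unfolding D_def by (rule diametral_walk(2)[OF conn fin that])
  have D1: "D \<ge> 1"
  proof -
    have "\<exists>u\<in>?V. \<exists>v\<in>?V. u \<noteq> v"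
    proof (rule ccontr)
      assume "\<not> ?thesis"
      then have "card ?V \<le> 1" using card_le_Suc0_iff_eq[OF fin] by auto
      then show False using big by simp
    qed
    then obtain u v where uv: "u \<in> ?V" "v \<in> ?V" "u \<noteq> v" by blast
    show ?thesis using distance_pos[OF conn uv] dD[OF uv(1,2)] by linarith
  qed
  obtain q where q: "length q = Suc D" "set q \<subseteq> ?V"
    "\<And>i j. i \<le> j \<Longrightarrow> j \<le> D \<Longrightarrow> ?d (q ! i) (q ! j) = j - i"
    "\<And>i. i < D \<Longrightarrow> {q ! i, q ! Suc i} \<in> edges T"
    using diametral_walk(1)[OF conn fin] unfolding D_def by blast
  have qV: "q ! i \<in> ?V" if "i \<le> D" for i
    using q(1,2) that nth_mem[of i q] by auto
  define H r where "H = D div 2" and "r = D - H"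
  have rH: "r + H = D" "H \<le> r" "r \<le> Suc H" "Suc H \<le> D" using D1 unfolding H_def r_def by auto
  define c where "c = q ! H"
  have cV: "c \<in> ?V" unfolding c_def using qV rH by simp
  obtain p where p: "rooted_tree ?V c p (?d c)" and G: "parent_graph ?V c p = T"
    and dep: "\<And>v. v \<in> ?V \<Longrightarrow> v \<noteq> c \<Longrightarrow> ?d c v = Suc (?d c (p v))"
    using tree_as_parent_graph[OF T cV] by blast
  interpret R: rooted_tree ?V c p "?d c" by (rule p)
  have dep_left: "?d c (q ! i) = H - i" if "i \<le> H" for i
    unfolding c_def distance_sym[of T "q ! H"] using q(3)[of i H] that rH by simp
  have dep_right: "?d c (q ! i) = i - H" if "H \<le> i" "i \<le> D" for i
    unfolding c_def using q(3)[OF that] .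
  have dc: "?d c c = 0" using distance_self[OF cV] .
  have par_edge: "p v = u" if "{u, v} \<in> edges T" "?d c u < ?d c v" for u v
  proof -
    have "{u, v} \<in> edges R.G" using that(1) G by simp
    then show ?thesis
    proof (cases rule: R.edge_cases)
      case 1
      then show ?thesis using R.dep_parent[OF 1(1,2)] that(2) by simp
    qed simp
  qed
  have p_left: "p (q ! i) = q ! Suc i" if "i < H" for i
    using q(4)[of i] that rH dep_left[of i] dep_left[of "Suc i"]
    by (intro par_edge) (simp_all add: insert_commute)
  have p_right: "p (q ! Suc i) = q ! i" if "H \<le> i" "i < D" for i
    using q(4)[OF that(2)] that dep_right[of i] dep_right[of "Suc i"] by (intro par_edge) simp_all
  define y' where "y' = q ! Suc H"
  have y'V: "y' \<in> ?V" and dy': "?d c y' = 1" and py': "p y' = c"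
    unfolding y'_def c_def using qV[OF rH(4)] dep_right[OF _ rH(4)] p_right[of H] rH(4)
    by (simp_all add: c_def)
  have y'c: "y' \<noteq> c" using dy' dc by auto
  let ?B = "R.below y'"
  have dep_B: "u = y' \<or> 1 < ?d c u" if "u \<in> ?B" for u
    using R.up_dep[of u y'] that dy' unfolding R.below_def by auto
  have cB: "c \<notin> ?B" using dep_B[of c] y'c dc by auto
  have right_B: "q ! i \<in> ?B" if "Suc H \<le> i" "i \<le> D" for i
    using that
  proof (induction i rule: dec_induct)
    case base then show ?case using R.self_below[OF y'V] unfolding y'_def by simp
  next
    case (step i)
    have "p (q ! Suc i) \<in> ?B" using p_right[of i] step by simp
    moreover have "q ! Suc i \<noteq> c" using dep_right[of "Suc i"] step.hyps step.prems dc by auto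
    ultimately show ?case using R.parent_below_iff qV[OF step.prems] by blast
  qed
  have left_B: "q ! (H - h) \<notin> ?B" if "h \<le> H" for h
    using that
  proof (induction h)
    case 0 then show ?case using cB unfolding c_def by simp
  next
    case (Suc h)
    let ?u = "q ! (H - Suc h)"
    have pu: "p ?u = q ! (H - h)" using p_left[of "H - Suc h"] Suc.prems by (simp add: Suc_diff_Suc)
    have "?d ?u y' = Suc h + 1"
      unfolding y'_def using q(3)[of "H - Suc h" "Suc H"] Suc.prems rH(4) by simp
    then have "?u \<noteq> y'" using distance_self[OF y'V] by auto
    then show ?case using R.below_parent(1)[of ?u y'] pu Suc.IH Suc.prems by auto
  qed
  have dist_out: "?d u w = ?d c u + ?d c w" if "u \<in> ?B" "w \<in> ?V" "w \<notin> ?B" for u w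
    using R.distance_leaving(1)[OF that] unfolding py' G by (simp add: distance_sym[of T u c])
  have dep_in: "?d c u = Suc (?d y' u)" if "u \<in> ?B" for u
    using R.distance_leaving(2)[OF that cV cB] dy' unfolding G
    by (simp add: distance_sym[of T u] distance_sym[of T y' c])
  have BV: "u \<in> ?V" if "u \<in> ?B" for u using that R.below_subset by auto
  have dep_B_le: "?d c u + H \<le> D" if "u \<in> ?B" for u
    using dist_out[OF that qV[of 0] left_B[of H, simplified]] dep_left[of 0] dD[OF BV[OF that] qV[of 0]] by simp
  have dep_out_le: "r + ?d c u \<le> D" if "u \<in> ?V" "u \<notin> ?B" for u
    using dist_out[OF right_B[of D] that] dep_right[of D] dD[OF qV[of D] that(1)] rH by simp
  have dep_le: "?d c u \<le> r" if "u \<in> ?V" for u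
    using dep_B_le[of u] dep_out_le[OF that] rH by (cases "u \<in> ?B") linarith+
  have ecc_eqI: "eccentricity T u = m"
    if "w \<in> ?V" "?d u w = m" "\<And>v. v \<in> ?V \<Longrightarrow> ?d u v \<le> m" for u w m
    unfolding eccentricity_def using fin that by (intro Max_eqI) auto
  have ecc_B: "eccentricity T u = ?d c u + H" if u: "u \<in> ?B" for u
  proof (rule ecc_eqI)
    show "q ! 0 \<in> ?V" using qV by simp
    show "?d u (q ! 0) = ?d c u + H"
      using dist_out[OF u qV[of 0] left_B[of H, simplified]] dep_left[of 0] by simp
    fix w assume w: "w \<in> ?V"
    show "?d u w \<le> ?d c u + H"
    proof (cases "w \<in> ?B")
      case True
      have "?d u w \<le> ?d u y' + ?d y' w" by (rule distance_triangle[OF conn BV[OF u] y'V w])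
      then show ?thesis
        using dep_in[OF u] dep_in[OF True] dep_le[OF w] rH distance_sym[of T u y'] by linarith
    next
      case False
      then show ?thesis using dist_out[OF u w False] dep_out_le[OF w False] rH by linarith
    qed
  qed
  have ecc_out: "eccentricity T u = r + ?d c u" if u: "u \<in> ?V" "u \<notin> ?B" for u
  proof (rule ecc_eqI)
    show "q ! D \<in> ?V" using qV by simp
    show "?d u (q ! D) = r + ?d c u"
      using dist_out[OF right_B[of D] u] dep_right[of D] rH by (simp add: distance_sym[of T u "q ! D"])
    fix w assume w: "w \<in> ?V"
    have "?d u w \<le> ?d u c + ?d c w" by (rule distance_triangle[OF conn u(1) cV w])
    then show "?d u w \<le> r + ?d c u" using dep_le[OF w] distance_sym[of T u c] by linarith
  qed
  \<comment> \<open>For odd \<open>D\<close> the centre is the edge from \<open>c\<close> to \<open>y'\<close>, so levels beyond \<open>y'\<close> count from \<open>y'\<close>; then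
    \<open>r - H = 1\<close>. For even \<open>D\<close> it is \<open>0\<close>.\<close>
  define lev where "lev u = (if u \<in> ?B then ?d c u - (r - H) else ?d c u)" for u
  define x where "x h = q ! (H - h)" for h
  define y where "y h = q ! (r + h)" for h
  have dep_B_pos: "1 \<le> ?d c u" if "u \<in> ?B" for u using dep_in[OF that] by simp
  have x0: "x 0 = c" unfolding x_def c_def by simp
  have y0: "y 0 = (if r = H then c else y')"
    unfolding y_def c_def y'_def using rH by (auto simp: le_Suc_eq)
  have y_cases: "y h \<in> ?B \<or> (h = 0 \<and> y h = c \<and> r = H)" if "h \<le> H" for h
  proof (cases "Suc H \<le> r + h")
    case True then show ?thesis unfolding y_def using right_B[OF True] that rH by simp
  next
    case False
    then have "h = 0" "r = H" using rH by auto
    then show ?thesis using y0 by simp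
  qed
  have lev_y: "lev (y h) = h" if "h \<le> H" for h
  proof -
    have "?d c (y h) = r + h - H" unfolding y_def using dep_right[of "r + h"] that rH by simp
    then show ?thesis using y_cases[OF that] dc cB rH unfolding lev_def by auto
  qed
  have lev_x: "lev (x h) = h" if "h \<le> H" for h
    unfolding lev_def x_def using left_B[OF that] dep_left[of "H - h"] that by simp
  have levc: "lev c = 0" unfolding lev_def using cB dc by simp
  have not_c: "u \<noteq> c" if "lev u > 0" for u using that levc by auto
  have L: "levelled_tree ?V p lev x y H"
  proof
    show "finite ?V" by (rule fin)
    fix v assume v: "v \<in> ?V"
    show "lev v \<le> H"
      using dep_B_le[of v] dep_out_le[OF v] rH unfolding lev_def by (cases "v \<in> ?B") simp_all
    show "v = x 0 \<or> v = y 0" if "lev v = 0"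
    proof (cases "v \<in> ?B")
      case True
      then have "?d c v \<le> r - H" using that unfolding lev_def by simp
      then have "?d c v = 1" "r \<noteq> H" using dep_B_pos[OF True] rH by linarith+
      then show ?thesis using dep_B[OF True] y0 by simp
    next
      case False
      then have "?d c v = 0" using that unfolding lev_def by simp
      then show ?thesis using distance_pos[OF conn cV v] x0 by auto
    qed
    assume pos: "0 < lev v"
    show "p v \<in> ?V" using R.parent_in[OF v not_c[OF pos]] .
    have dv: "?d c v = Suc (?d c (p v))" by (rule dep[OF v not_c[OF pos]])
    show "Suc (lev (p v)) = lev v"
    proof (cases "v \<in> ?B")
      case False
      then have "p v \<notin> ?B" using R.parent_below_iff[OF v not_c[OF pos]] by blast
      then show ?thesis using False dv unfolding lev_def by simp
    next
      case True
      show ?thesis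
      proof (cases "v = y'")
        case yes: True
        then have "r - H = 0" using pos True dy' unfolding lev_def by simp
        then have "lev v = 1" using yes True dy' unfolding lev_def by simp
        then show ?thesis using yes py' levc by simp
      next
        case False
        have "p v \<in> ?B" by (rule R.below_parent(1)[OF True False])
        then show ?thesis using True pos dv unfolding lev_def by simp
      qed
    qed
  next
    fix h
    show "x h \<in> ?V" if "h \<le> H" unfolding x_def using qV[of "H - h"] that rH by simp
    show "y h \<in> ?V" if "h \<le> H" unfolding y_def using qV[of "r + h"] that rH by simp
    show "lev (x h) = h" "lev (y h) = h" if "h \<le> H" using that by (rule lev_x, rule lev_y)
    show "p (x (Suc h)) = x h" if "h < H"
      unfolding x_def using p_left[of "H - Suc h"] that by (simp add: Suc_diff_Suc)
    show "p (y (Suc h)) = y h" if "h < H"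
      unfolding y_def using p_right[of "r + h"] that rH by simp
    show "x h \<noteq> y h" if "1 \<le> h" "h \<le> H"
      using y_cases[OF that(2)] left_B[OF that(2)] that(1) unfolding x_def by auto
  qed
  moreover have "levelled_graph ?V p lev (x 0) (y 0) = T"
  proof -
    have upd: "(p(y 0 := c)) v = p v" if "v \<noteq> c" for v
      using that y0 py' by (simp split: if_splits)
    have "{{v, (p(y 0 := c)) v} | v. v \<in> ?V - {c}} = {{v, p v} | v. v \<in> ?V - {c}}"
      by (rule Collect_cong) (metis upd Diff_iff singletonI)
    then have "parent_graph ?V c (p(y 0 := c)) = parent_graph ?V c p"
      unfolding parent_graph_def by (rule arg_cong)
    then show ?thesis
      using levelled_tree.rooted_graph[OF L] G unfolding levelled_tree.rparent_def[OF L] x0 by simp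
  qed
  moreover have "\<forall>v\<in>?V. eccentricity T v = r + lev v"
  proof
    fix v assume v: "v \<in> ?V"
    show "eccentricity T v = r + lev v"
      using ecc_B[of v] ecc_out[OF v] dep_B_pos[of v] rH unfolding lev_def by (cases "v \<in> ?B") simp_all
  qed
  moreover have "diameter T = r + H" using rH D_def by simp
  moreover have "r = (if x 0 = y 0 then H else Suc H)"
    using x0 y0 y'c rH by (auto split: if_splits)
  ultimately show ?thesis by blast
qed

section \<open>Eccentric sequences and level sizes\<close>

lemma count_eccentric_sequence:
  assumes "finite (verts G)"
  shows "count_list (eccentric_sequence G) b = card {v \<in> verts G. eccentricity G v = b}"
proof -
  have "count_list (eccentric_sequence G) b = count (mset (eccentric_sequence G)) b"
    by (rule count_mset[symmetric])
  also have "\<dots> = count (image_mset (eccentricity G) (mset_set (verts G))) b"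
    unfolding eccentric_sequence_def by simp
  also have "\<dots> = (\<Sum>v\<in>{v \<in> verts G. eccentricity G v = b}. 1)"
    unfolding count_image_mset using assms by (intro sum.cong) auto
  finally show ?thesis by simp
qed

text \<open>
Each level up to \<open>H\<close> contains a spine vertex, so the eccentricities are exactly \<open>r, \<dots>, r + H\<close>.
\<close>
lemma (in levelled_tree) short_form_levels:
  assumes V: "verts G' = V" and ecc: "\<And>v. v \<in> V \<Longrightarrow> eccentricity G' v = r + lev v"
  shows "short_form (eccentric_sequence G') = (r, map w [1..<Suc H])"
proof -
  let ?S = "eccentric_sequence G'"
  have img: "eccentricity G' ` V = {r..<r + Suc H}"
  proof (intro subset_antisym subsetI)
    fix b assume "b \<in> eccentricity G' ` V"
    then obtain v where "v \<in> V" "b = r + lev v" using ecc by auto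
    then show "b \<in> {r..<r + Suc H}" using lev_le[of v] by simp
  next
    fix b assume b: "b \<in> {r..<r + Suc H}"
    then have h: "b - r \<le> H" by auto
    have "eccentricity G' (x (b - r)) = b" using ecc[OF x_in[OF h]] lev_x[OF h] b by simp
    then show "b \<in> eccentricity G' ` V" using x_in[OF h] by (metis image_eqI)
  qed
  have "set ?S = eccentricity G' ` V"
    unfolding eccentric_sequence_def using V finite_V by simp
  then have "remdups ?S = [r..<r + Suc H]"
    using sorted_distinct_set_unique[of "remdups ?S" "[r..<r + Suc H]"] img
    by (simp del: upt_Suc add: eccentric_sequence_def sorted_remdups)
  then have rem: "remdups ?S = r # [Suc r..<r + Suc H]" by (simp add: upt_conv_Cons)
  have "map (count_list ?S) [Suc r..<r + Suc H] = map w [1..<Suc H]"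
  proof (rule nth_equalityI)
    fix i assume "i < length (map (count_list ?S) [Suc r..<r + Suc H])"
    then have i: "i < H" by (simp del: upt_Suc)
    have "count_list ?S (Suc r + i) = card {v \<in> V. eccentricity G' v = Suc r + i}"
      using count_eccentric_sequence[of G'] V finite_V by simp
    also have "{v \<in> V. eccentricity G' v = Suc r + i} = level (Suc i)"
      unfolding level_def using ecc by auto
    finally have "count_list ?S (Suc r + i) = w (Suc i)" .
    moreover have "[Suc r..<r + Suc H] ! i = Suc r + i" "[1..<Suc H] ! i = Suc i"
      using i by (simp_all del: upt_Suc)
    ultimately show "map (count_list ?S) [Suc r..<r + Suc H] ! i = map w [1..<Suc H] ! i"
      using i by (simp del: upt_Suc)
  qed (simp del: upt_Suc)
  then show ?thesis unfolding short_form_def rem by (simp del: upt_Suc)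
qed

section \<open>The levels of the extremal tree\<close>

text \<open>
The spine \<open>v\<^sub>0, \<dots>, v\<^sub>d\<close> of the extremal tree has its centre at \<open>v\<^sub>H\<close> and \<open>v\<^sub>r\<close>, where \<open>d = r + H\<close> and
\<open>r\<close> is \<open>H\<close> or \<open>H + 1\<close>. The half towards \<open>v\<^sub>0\<close>, which carries the pendent edges, serves as the
spine \<open>x\<close>.
\<close>
fun extremal_parent :: "nat \<Rightarrow> caterpillar_vertex \<Rightarrow> caterpillar_vertex" where
  "extremal_parent H (Spine i) = (if i < H then Spine (Suc i) else Spine (i - 1))"
| "extremal_parent H (Pendant j t) = Spine (H + 2 - j)"

fun extremal_level :: "nat \<Rightarrow> nat \<Rightarrow> caterpillar_vertex \<Rightarrow> nat" where
  "extremal_level r H (Spine i) = (if i \<le> H then H - i else i - r)"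
| "extremal_level r H (Pendant j t) = j - 1"

abbreviation extremal_verts :: "nat \<Rightarrow> nat list \<Rightarrow> caterpillar_vertex set" where
  "extremal_verts r ms \<equiv> verts (extremal_tree r ms)"

lemma extremal_verts_eq:
  "extremal_verts r ms = Spine ` {..r + length ms}
    \<union> {Pendant j t | j t. 2 \<le> j \<and> j \<le> Suc (length ms) \<and> 1 \<le> t \<and> t \<le> ms ! (j - 2) - 2}"
  unfolding extremal_tree_def Let_def by auto

lemma finite_extremal_verts: "finite (extremal_verts r ms)"
proof -
  have "{Pendant j t | j t. 2 \<le> j \<and> j \<le> Suc (length ms) \<and> 1 \<le> t \<and> t \<le> ms ! (j - 2) - 2}
    \<subseteq> (\<Union>j\<in>{..Suc (length ms)}. Pendant j ` {..ms ! (j - 2) - 2})" by auto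
  then have "finite {Pendant j t | j t. 2 \<le> j \<and> j \<le> Suc (length ms) \<and> 1 \<le> t \<and> t \<le> ms ! (j - 2) - 2}"
    by (rule finite_subset) simp
  then show ?thesis unfolding extremal_verts_eq by simp
qed

lemma extremal_verts_cases:
  assumes "v \<in> extremal_verts r ms"
  obtains i where "v = Spine i" "i \<le> r + length ms"
    | j t where "v = Pendant j t" "2 \<le> j" "j \<le> Suc (length ms)" "1 \<le> t" "t \<le> ms ! (j - 2) - 2"
  using assms unfolding extremal_verts_eq by auto

lemma spine_in_extremal: "Spine i \<in> extremal_verts r ms \<longleftrightarrow> i \<le> r + length ms"
  unfolding extremal_verts_eq by auto

context
  fixes r H :: nat and ms :: "nat list"
  assumes len: "length ms = H" and r_cases: "r = H \<or> r = Suc H"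
begin

lemma extremal_levelled_tree:
  "levelled_tree (extremal_verts r ms) (extremal_parent H) (extremal_level r H)
    (\<lambda>h. Spine (H - h)) (\<lambda>h. Spine (r + h)) H"
proof
  show "finite (extremal_verts r ms)" by (rule finite_extremal_verts)
  fix v assume v: "v \<in> extremal_verts r ms"
  show "extremal_level r H v \<le> H"
    using v by (cases rule: extremal_verts_cases) (use len in auto)
  show "v = Spine (H - 0) \<or> v = Spine (r + 0)" if "extremal_level r H v = 0"
    using v by (cases rule: extremal_verts_cases) (use that r_cases in \<open>auto split: if_splits\<close>)
  assume pos: "0 < extremal_level r H v"
  show "extremal_parent H v \<in> extremal_verts r ms"
    using v by (cases rule: extremal_verts_cases) (use pos r_cases len in \<open>auto simp: spine_in_extremal\<close>)
  show "Suc (extremal_level r H (extremal_parent H v)) = extremal_level r H v"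
    using v by (cases rule: extremal_verts_cases) (use pos r_cases len in \<open>auto split: if_splits\<close>)
next
  fix h
  show "Spine (H - h) \<in> extremal_verts r ms" if "h \<le> H" using len by (simp add: spine_in_extremal)
  show "Spine (r + h) \<in> extremal_verts r ms" if "h \<le> H" using that len by (simp add: spine_in_extremal)
  show "extremal_level r H (Spine (H - h)) = h" if "h \<le> H" using that by simp
  show "extremal_level r H (Spine (r + h)) = h" if "h \<le> H" using r_cases by auto
  show "extremal_parent H (Spine (H - Suc h)) = Spine (H - h)" if "h < H" using that by auto
  show "extremal_parent H (Spine (r + Suc h)) = Spine (r + h)" if "h < H" using r_cases by auto
  show "Spine (H - h) \<noteq> Spine (r + h)" if "1 \<le> h" "h \<le> H" using that r_cases by auto
qed

lemma extremal_graph: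
  "levelled_graph (extremal_verts r ms) (extremal_parent H) (extremal_level r H) (Spine H) (Spine r)
    = extremal_tree r ms"
proof -
  let ?P = "\<lambda>j t. 2 \<le> j \<and> j \<le> Suc H \<and> 1 \<le> t \<and> t \<le> ms ! (j - 2) - 2"
  let ?L = "{{v, extremal_parent H v} | v. v \<in> extremal_verts r ms \<and> 0 < extremal_level r H v}
    \<union> (if Spine H = Spine r then {} else {{Spine H, Spine r}})"
  let ?R = "{{Spine i, Spine (i + 1)} | i. i < r + H} \<union> {{Spine (H + 2 - j), Pendant j t} | j t. ?P j t}"
  have "?L = ?R"
  proof (intro subset_antisym subsetI)
    fix e assume "e \<in> ?L"
    then consider v where "v \<in> extremal_verts r ms" "0 < extremal_level r H v" "e = {v, extremal_parent H v}"
      | "r = Suc H" "e = {Spine H, Spine (H + 1)}"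
      using r_cases by (auto split: if_splits)
    then show "e \<in> ?R"
    proof cases
      case 1
      from 1(1) show ?thesis
      proof (cases rule: extremal_verts_cases)
        case (1 i)
        show ?thesis
        proof (cases "i < H")
          case True
          then have "e = {Spine i, Spine (i + 1)}" "i < r + H" using \<open>e = _\<close> 1 r_cases by auto
          then show ?thesis by blast
        next
          case False
          then have "e = {Spine (i - 1), Spine (i - 1 + 1)}" "i - 1 < r + H"
            using \<open>e = _\<close> \<open>0 < _\<close> 1 len by (auto split: if_splits)
          then show ?thesis by blast
        qed
      next
        case (2 j t)
        then have "e = {Spine (H + 2 - j), Pendant j t}" "?P j t" using \<open>e = _\<close> len by auto
        then show ?thesis by blast
      qed
    next
      case 2
      then have "H < r + H" by simp
      then show ?thesis using 2(2) by blast
    qed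
  next
    fix e assume "e \<in> ?R"
    then consider i where "i < r + H" "e = {Spine i, Spine (i + 1)}"
      | j t where "?P j t" "e = {Spine (H + 2 - j), Pendant j t}" by blast
    then show "e \<in> ?L"
    proof cases
      case (1 i)
      consider "i < H" | "i = H" "r = Suc H" | "H \<le> i" "0 < extremal_level r H (Spine (i + 1))"
        using r_cases by fastforce
      then show ?thesis
      proof cases
        case a: 1
        then have "e = {Spine i, extremal_parent H (Spine i)}" "0 < extremal_level r H (Spine i)"
          "Spine i \<in> extremal_verts r ms" using 1 len by (simp_all add: spine_in_extremal)
        then show ?thesis by blast
      next
        case 2
        then show ?thesis using 1 by simp
      next
        case 3
        then have "e = {Spine (i + 1), extremal_parent H (Spine (i + 1))}"
          "Spine (i + 1) \<in> extremal_verts r ms" using 1 len by (auto simp: spine_in_extremal)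
        then show ?thesis using 3(2) by blast
      qed
    next
      case (2 j t)
      have "Pendant j t \<in> extremal_verts r ms" using 2(1) len unfolding extremal_verts_eq by blast
      moreover have "0 < extremal_level r H (Pendant j t)" using 2(1) by simp
      moreover have "e = {Pendant j t, extremal_parent H (Pendant j t)}" using 2(2) by auto
      ultimately show ?thesis by blast
    qed
  qed
  moreover have "edges (extremal_tree r ms) = ?R"
    unfolding extremal_tree_def Let_def using len by simp
  ultimately show ?thesis unfolding levelled_graph_def by simp
qed

lemma extremal_one_sided:
  "one_sided (extremal_verts r ms) (extremal_parent H) (extremal_level r H)
    (\<lambda>h. Spine (H - h)) (\<lambda>h. Spine (r + h))"
  unfolding one_sided_def
proof (intro ballI impI)
  fix v assume v: "v \<in> extremal_verts r ms"
    and off: "v \<noteq> Spine (H - extremal_level r H v)" "v \<noteq> Spine (r + extremal_level r H v)"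
  from v show "extremal_parent H v = Spine (H - (extremal_level r H v - 1))"
  proof (cases rule: extremal_verts_cases)
    case (1 i)
    then show ?thesis using off r_cases by (auto split: if_splits)
  next
    case (2 j t)
    then show ?thesis using len by simp
  qed
qed

lemma card_extremal_level:
  assumes h: "h \<in> {1..H}" and m: "2 \<le> ms ! (h - 1)"
  shows "card {v \<in> extremal_verts r ms. extremal_level r H v = h} = ms ! (h - 1)"
proof -
  let ?m = "ms ! (h - 1) - 2"
  have "{v \<in> extremal_verts r ms. extremal_level r H v = h}
    = {Spine (H - h), Spine (r + h)} \<union> Pendant (Suc h) ` {1..?m}" (is "?L = ?R")
  proof (intro subset_antisym subsetI)
    fix v assume "v \<in> ?L"
    then have v: "v \<in> extremal_verts r ms" "extremal_level r H v = h" by simp_all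
    from v(1) show "v \<in> ?R"
    proof (cases rule: extremal_verts_cases)
      case (1 i)
      then show ?thesis using v(2) h r_cases by (auto split: if_splits)
    next
      case (2 j t)
      then have "j = Suc h" using v(2) by simp
      then show ?thesis using 2 by simp
    qed
  next
    fix v assume "v \<in> ?R"
    then consider "v = Spine (H - h)" | "v = Spine (r + h)"
      | t where "v = Pendant (Suc h) t" "1 \<le> t" "t \<le> ?m" by auto
    then show "v \<in> ?L"
    proof cases
      case 1 then show ?thesis using h len by (simp add: spine_in_extremal)
    next
      case 2 then show ?thesis using h len r_cases by (auto simp: spine_in_extremal)
    next
      case 3 then show ?thesis using h len unfolding extremal_verts_eq by auto
    qed
  qed
  moreover have "card (Pendant (Suc h) ` {1..?m}) = ?m"
    by (subst card_image) (auto intro: inj_onI)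
  moreover have "H - h \<noteq> r + h" using h r_cases by auto
  moreover have "{Spine (H - h), Spine (r + h)} \<inter> Pendant (Suc h) ` {1..?m} = {}" by auto
  ultimately show ?thesis using m by (simp add: card_Un_disjoint)
qed

end

section \<open>The comparison\<close>

lemma level_lower_bound_cong:
  assumes "\<And>h. h \<le> H \<Longrightarrow> w h = w' h"
  shows "level_lower_bound k H w = level_lower_bound k H w'"
proof -
  have tail: "(\<Sum>i\<in>{h..H}. w i) = (\<Sum>i\<in>{h..H}. w' i)" for h
    by (rule sum.cong) (simp_all add: assms)
  have total: "(\<Sum>i\<le>H. w i) = (\<Sum>i\<le>H. w' i)"
    by (rule sum.cong) (simp_all add: assms)
  have "(\<Sum>h\<in>{1..H}. level_min n k (Suc H - h) (w h) (\<Sum>i\<in>{h..H}. w i))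
    = (\<Sum>h\<in>{1..H}. level_min n k (Suc H - h) (w' h) (\<Sum>i\<in>{h..H}. w' i))" for n
    by (rule sum.cong) (simp_all add: assms tail)
  then show ?thesis unfolding level_lower_bound_def Let_def total assms[OF le0] by simp
qed

text \<open>
The extremal tree has the same level sizes as \<open>T\<close> and attains the lower bound that depends on them only.
The two spines of \<open>T\<close> can be exchanged, so both outcomes of the case of equality lead to the same tree.
\<close>
theorem theorem3:
  fixes S :: "nat list" and r :: nat and ms :: "nat list"
    and T :: "'a ugraph" and n d k :: nat
  assumes "tree_eccentric_sequence S"
    and "short_form S = (r, ms)"
    and "T \<in> trees_with S"
    and "n = order T"
    and "d = diameter T"
    and "k \<in> {2..n - 1}"
  shows "steiner_wiener k T \<ge> steiner_wiener k (extremal_tree r ms)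
    \<and> (int k \<le> int n - \<lceil>real d / 2\<rceil> \<longrightarrow>
         steiner_wiener k T = steiner_wiener k (extremal_tree r ms) \<longrightarrow>
         isomorphic T (extremal_tree r ms))"
proof -
  have T: "is_tree T" and S: "S = eccentric_sequence T" using assms(3) unfolding trees_with_def by auto
  have n: "n = card (verts T)" using assms(4) unfolding order_def .
  have k: "2 \<le> k" "1 \<le> k" and big: "card (verts T) > 1" using assms(6) n by auto
  obtain r' H par lev x y where A: "levelled_tree (verts T) par lev x y H"
    and G: "levelled_graph (verts T) par lev (x 0) (y 0) = T"
    and ecc: "\<And>v. v \<in> verts T \<Longrightarrow> eccentricity T v = r' + lev v"
    and d: "diameter T = r' + H" and r': "r' = (if x 0 = y 0 then H else Suc H)"
    using tree_levels[OF T big] by blast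
  interpret A: levelled_tree "verts T" par lev x y H by (rule A)
  have "short_form S = (r', map A.w [1..<Suc H])"
    unfolding S by (rule A.short_form_levels[OF refl ecc])
  then have r: "r = r'" and ms: "ms = map A.w [1..<Suc H]" using assms(2) by simp_all
  have len: "length ms = H" unfolding ms by simp
  have r_cases: "r = H \<or> r = Suc H" using r r' by (simp split: if_splits)
  have msh: "ms ! (h - 1) = A.w h" if "h \<in> {1..H}" for h
    using that unfolding ms by (auto simp del: upt_Suc)
  have two: "2 \<le> A.w h" if h: "h \<in> {1..H}" for h
  proof -
    have "card {x h, y h} \<le> A.w h"
      using A.level_assms(1-3)[OF h] by (intro card_mono) simp_all
    then show ?thesis using A.level_assms(4)[OF h] by simp
  qed
  let ?V = "extremal_verts r ms" let ?x = "\<lambda>h. Spine (H - h)" let ?y = "\<lambda>h. Spine (r + h)"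
  have B: "levelled_tree ?V (extremal_parent H) (extremal_level r H) ?x ?y H"
    by (rule extremal_levelled_tree[OF len r_cases])
  interpret B: levelled_tree ?V "extremal_parent H" "extremal_level r H" ?x ?y H by (rule B)
  have GB: "levelled_graph ?V (extremal_parent H) (extremal_level r H) (?x 0) (?y 0) = extremal_tree r ms"
    using extremal_graph[OF len r_cases] by simp
  have cards: "A.w h = B.w h" if h: "h \<le> H" for h
  proof (cases "h = 0")
    case True
    have "x 0 = y 0 \<longleftrightarrow> Spine H = Spine r" using r r' by auto
    then show ?thesis using A.card_level_0 B.card_level_0 True by simp
  next
    case False
    then have h': "h \<in> {1..H}" using h by simp
    have "B.w h = ms ! (h - 1)"
      unfolding B.level_def using msh[OF h'] two[OF h'] by (intro card_extremal_level[OF len r_cases h']) simp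
    then show ?thesis using msh[OF h'] by simp
  qed
  have bound: "level_lower_bound k H A.w = int (steiner_wiener k (extremal_tree r ms))"
    using B.steiner_wiener_one_sided[OF extremal_one_sided[OF len r_cases] k(2)] GB
      level_lower_bound_cong[OF cards] by simp
  have ge: "steiner_wiener k T \<ge> steiner_wiener k (extremal_tree r ms)"
    using A.steiner_wiener_lower[OF k(2)] bound G by simp
  have "isomorphic T (extremal_tree r ms)"
    if small: "int k \<le> int n - \<lceil>real d / 2\<rceil>"
      and eq: "steiner_wiener k T = steiner_wiener k (extremal_tree r ms)"
  proof -
    have "\<lceil>real d / 2\<rceil> = int r"
    proof -
      have "real d = real r + real H" unfolding assms(5) d r by simp
      moreover have "real r = real H \<or> real r = real H + 1" using r_cases by auto
      ultimately have "of_int (int r) - 1 < real d / 2" "real d / 2 \<le> of_int (int r)" by auto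
      then show ?thesis by (rule ceiling_unique)
    qed
    then have "k + r \<le> card (verts T)" using small n by linarith
    moreover have "H + A.w 0 - 1 = r" unfolding A.card_level_0 using r r' by (simp split: if_splits)
    ultimately have small': "k + (H + A.w 0 - 1) \<le> card (verts T)" by (simp only:)
    have "int (steiner_wiener k A.G) = level_lower_bound k H A.w"
      unfolding bound G eq ..
    from A.steiner_wiener_equality[OF k(1) small' big this]
    have "one_sided (verts T) par lev x y \<or> one_sided (verts T) par lev y x" .
    then show ?thesis
    proof
      assume os: "one_sided (verts T) par lev x y"
      have "isomorphic A.G B.G"
        by (rule one_sided_isomorphic[OF A os B extremal_one_sided[OF len r_cases] cards])
      then show ?thesis unfolding G GB .
    next
      assume os: "one_sided (verts T) par lev y x"
      have "levelled_graph (verts T) par lev (y 0) (x 0) = T"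
        using G unfolding levelled_graph_commute[of _ _ _ "y 0"] .
      moreover have "isomorphic (levelled_graph (verts T) par lev (y 0) (x 0)) B.G"
        by (rule one_sided_isomorphic[OF A.swapped os B extremal_one_sided[OF len r_cases] cards])
      ultimately show ?thesis unfolding GB by simp
    qed
  qed
  with ge show ?thesis by blast
qed

end
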